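(* Let $n\ge2$ and let $\Omega$ be a bounded domain of $\mathbb{H}^n$ satisfying a uniform exterior geodesic ball condition. Let $H\in C^1(\mathcal{C}_{\overline\Omega})$ be such that $H>0$ and $\frac{\partial}{\partial\lambda}\big(\lambda H(\lambda q)\big)\le0$ for all $q\in\overline\Omega$ and $\lambda>0$. Then $(\Omega,H)$ is admissible.
   Context: The Lorentz-Minkowski space $\mathbb{L}^{n+1}$ is $\mathbb{R}^{n+1}$ with the bilinear form $\langle x,y\rangle=x_1y_1+\dots+x_ny_n-x_{n+1}y_{n+1}$. The hyperbolic space is $\mathbb{H}^n=\{x\in\mathbb{L}^{n+1}:\langle x,x\rangle=-1,\ x_{n+1}>0\}$, with the Riemannian metric $g$ induced by $\langle\cdot,\cdot\rangle$. $\nabla u$ is the gradient with respect to $g$, $|\nabla u|$ its $g$-norm; $u_i$ and $u_{ij}$ are the components of the first covariant derivative and of the Hessian of $u$ in a local $g$-orthonormal frame. A domain is a connected open set. $\mathcal{C}_{\overline\Omega}:=\{\rho q:\ q\in\overline\Omega,\ \rho>0\}$. $\Omega$ satisfies a uniform exterior geodesic ball condition if there exist $\sigma>0$ and a map $\Xi:\partial\Omega\to\mathbb{H}^n$ of class $C^2$ such that for every $q_0\in\partial\Omega$, setting $\xi=\Xi(q_0)\in\mathbb{H}^n\setminus\overline\Omega$, the geodesic ball $B_\sigma(\xi)$ of $\mathbb{H}^n$ of radius $\sigma$ centered at $\xi$ satisfies $q_0\in\partial B_\sigma(\xi)$ and $B_\sigma(\xi)\subset\mathbb{H}^n\setminus\overline\Omega$.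 For $t\in[0,1]$ and $\varphi\in C^2(\overline\Omega)$ with $\sup_\Omega|\nabla\varphi|<1$ put $$\mathcal{Q}^t(\varphi):=\sum_{i,j=1}^n\big((1-|\nabla\varphi|^2)\delta_{ij}+\varphi_i\varphi_j\big)\varphi_{ij}-nt(1-|\nabla\varphi|^2)+nt(1-|\nabla\varphi|^2)^{3/2}e^{\varphi}H(e^{\varphi}q).$$ $(\Omega,H)$ is admissible if there is a constant $\theta\in(0,1)$ such that for every $q_0\in\partial\Omega$ and every $t\in[0,1]$ there exist $\varphi_1,\varphi_2\in C^2(\overline\Omega)$ with: $\sup_\Omega|\nabla\varphi_i|\le1-\theta$ for $i=1,2$; $\varphi_1(q_0)=0$ and $\varphi_1\le0$ on $\partial\Omega$; $\varphi_2(q_0)=0$ and $\varphi_2\ge0$ on $\partial\Omega$; $\mathcal{Q}^t(\varphi_1)\ge0$ and $\mathcal{Q}^t(\varphi_2)\le0$ in $\Omega$. *)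

theory Defs
  imports "HOL-Analysis.Analysis"
begin

text \<open>
  The space \<open>L\<^sup>n\<^sup>+\<^sup>1\<close> is \<open>(real^'n) \<times> real\<close> with \<open>n = CARD('n)\<close>; the second component is the
  last coordinate \<open>x\<^bsub>n+1\<^esub>\<close>.
\<close>

type_synonym 'n lspace = "(real ^ 'n) \<times> real"

definition lorentz :: "'n::finite lspace \<Rightarrow> 'n lspace \<Rightarrow> real" where
  "lorentz x y = (\<Sum>i\<in>UNIV. fst x $ i * fst y $ i) - snd x * snd y"

definition hyperbolic :: "'n::finite lspace set" where
  "hyperbolic = {x. lorentz x x = - 1 \<and> snd x > 0}"

abbreviation hyp_top :: "'n::finite lspace topology" where
  "hyp_top \<equiv> top_of_set hyperbolic"

definition tangent :: "'n::finite lspace \<Rightarrow> 'n lspace set" where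
  "tangent p = {v. lorentz p v = 0}"

text \<open>The \<open>g\<close>-norm; it is meaningful on tangent vectors, where \<^const>\<open>lorentz\<close> is positive
  definite.\<close>

definition gnorm :: "'n::finite lspace \<Rightarrow> real" where
  "gnorm v = sqrt (lorentz v v)"

text \<open>
  The Riemannian distance of \<open>g\<close>: infimum of the lengths of piecewise \<open>C\<^sup>1\<close> curves.  A
  \<^const>\<open>valid_path\<close> may have unbounded speed near a break point, hence infinite length; such
  curves are excluded by \<open>has_integral\<close>.
\<close>

definition hyp_dist :: "'n::finite lspace \<Rightarrow> 'n lspace \<Rightarrow> real" where
  "hyp_dist p q = Inf {L. \<exists>\<gamma>. valid_path \<gamma> \<and> path_image \<gamma> \<subseteq> hyperbolic \<and>
     pathstart \<gamma> = p \<and> pathfinish \<gamma> = q \<and>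
     ((\<lambda>s. gnorm (vector_derivative \<gamma> (at s))) has_integral L) {0..1}}"

definition geodesic_ball :: "'n::finite lspace \<Rightarrow> real \<Rightarrow> 'n lspace set" where
  "geodesic_ball \<xi> \<sigma> = {x \<in> hyperbolic. hyp_dist \<xi> x < \<sigma>}"

definition hyp_bounded :: "'n::finite lspace set \<Rightarrow> bool" where
  "hyp_bounded \<Omega> \<longleftrightarrow> (\<exists>p\<in>hyperbolic. \<exists>R. \<forall>q\<in>\<Omega>. hyp_dist p q \<le> R)"

definition hyp_domain :: "'n::finite lspace set \<Rightarrow> bool" where
  "hyp_domain \<Omega> \<longleftrightarrow> openin hyp_top \<Omega> \<and> connected \<Omega>"

definition cone_over :: "'n::finite lspace set \<Rightarrow> 'n lspace set" where
  "cone_over A = {\<rho> *\<^sub>R q | \<rho> q. q \<in> A \<and> \<rho> > 0}"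

text \<open>
  For \<open>S\<close> open and \<open>S \<subseteq> A \<subseteq> closure S\<close>: \<open>f\<close> is \<open>C\<^sup>k\<close> in \<open>S\<close> and \<open>f\<close> and its
  derivatives of order at most \<open>k\<close> extend continuously to \<open>A\<close>, the extension of \<open>f\<close> being \<open>f\<close>.
  With \<open>A = S\<close> this is \<open>C\<^sup>k(S)\<close>.
\<close>

definition C1_upto ::
  "'a::real_normed_vector set \<Rightarrow> 'a set \<Rightarrow> ('a \<Rightarrow> 'b::real_normed_vector) \<Rightarrow> bool" where
  "C1_upto S A f \<longleftrightarrow> continuous_on A f \<and>
     (\<exists>D. (\<forall>x\<in>S. (f has_derivative blinfun_apply (D x)) (at x)) \<and> continuous_on A D)"

definition C2_upto ::
  "'a::real_normed_vector set \<Rightarrow> 'a set \<Rightarrow> ('a \<Rightarrow> 'b::real_normed_vector) \<Rightarrow> bool" where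
  "C2_upto S A f \<longleftrightarrow> continuous_on A f \<and>
     (\<exists>D. (\<forall>x\<in>S. (f has_derivative blinfun_apply (D x)) (at x)) \<and> C1_upto S A D)"

text \<open>A map on an arbitrary set is \<open>C\<^sup>2\<close> if it is the restriction of a \<open>C\<^sup>2\<close> map on an open
  neighbourhood.\<close>

definition C2_map_on ::
  "'a::real_normed_vector set \<Rightarrow> ('a \<Rightarrow> 'b::real_normed_vector) \<Rightarrow> bool" where
  "C2_map_on A f \<longleftrightarrow> (\<exists>U F. open U \<and> A \<subseteq> U \<and> C2_upto U U F \<and> (\<forall>x\<in>A. F x = f x))"

text \<open>
  A function \<open>u\<close> on (a part of) the hyperboloid is differentiated through its radially constant
  extension \<open>u \<circ> radial\<close>, whose values near \<open>p\<close> only involve those of \<open>u\<close> on the hyperboloid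
  near \<open>p\<close>.
\<close>

definition radial :: "'n::finite lspace \<Rightarrow> 'n lspace" where
  "radial x = x /\<^sub>R sqrt (- lorentz x x)"

definition C2_closure :: "'n::finite lspace set \<Rightarrow> ('n lspace \<Rightarrow> real) \<Rightarrow> bool" where
  "C2_closure \<Omega> u \<longleftrightarrow>
     C2_upto (cone_over \<Omega>) (cone_over (hyp_top closure_of \<Omega>)) (\<lambda>x. u (radial x))"

definition hyp_deriv ::
  "('n::finite lspace \<Rightarrow> 'b::real_normed_vector) \<Rightarrow> 'n lspace \<Rightarrow> 'n lspace \<Rightarrow> 'b" where
  "hyp_deriv u p v = frechet_derivative (\<lambda>x. u (radial x)) (at p) v"

definition hyp_grad :: "('n::finite lspace \<Rightarrow> real) \<Rightarrow> 'n lspace \<Rightarrow> 'n lspace" where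
  "hyp_grad u p = (THE w. w \<in> tangent p \<and> (\<forall>v\<in>tangent p. lorentz w v = hyp_deriv u p v))"

text \<open>
  The Levi-Civita connection of the induced metric is the tangential part of the flat
  connection; as \<open>p\<close> is a normal vector with \<open>lorentz p p = -1\<close>, the tangential part of \<open>w\<close>
  at \<open>p\<close> is \<open>w + lorentz w p *\<^sub>R p\<close>.
\<close>

definition cov_deriv ::
  "('n::finite lspace \<Rightarrow> 'n lspace) \<Rightarrow> 'n lspace \<Rightarrow> 'n lspace \<Rightarrow> 'n lspace" where
  "cov_deriv X p v = hyp_deriv X p v + lorentz (hyp_deriv X p v) p *\<^sub>R p"

definition hyp_hess ::
  "('n::finite lspace \<Rightarrow> real) \<Rightarrow> 'n lspace \<Rightarrow> 'n lspace \<Rightarrow> 'n lspace \<Rightarrow> real" where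
  "hyp_hess u p v w = lorentz (cov_deriv (hyp_grad u) p v) w"

definition orthonormal_frame :: "'n::finite lspace \<Rightarrow> ('n \<Rightarrow> 'n lspace) \<Rightarrow> bool" where
  "orthonormal_frame p e \<longleftrightarrow> (\<forall>i. e i \<in> tangent p) \<and>
     (\<forall>i j. lorentz (e i) (e j) = (if i = j then 1 else 0))"

text \<open>The operator \<open>Q\<^sup>t\<close> at \<open>q\<close>, written in the orthonormal frame \<open>e\<close> at \<open>q\<close>; its value does not
  depend on \<open>e\<close>.\<close>

definition Qop ::
  "('n::finite lspace \<Rightarrow> real) \<Rightarrow> real \<Rightarrow> ('n lspace \<Rightarrow> real) \<Rightarrow> 'n lspace \<Rightarrow> ('n \<Rightarrow> 'n lspace) \<Rightarrow> real"
  where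
  "Qop H t \<phi> q e =
     (let n = real CARD('n); w = 1 - (gnorm (hyp_grad \<phi> q))\<^sup>2 in
       (\<Sum>i\<in>UNIV. \<Sum>j\<in>UNIV.
          (w * (if i = j then 1 else 0) + hyp_deriv \<phi> q (e i) * hyp_deriv \<phi> q (e j))
            * hyp_hess \<phi> q (e i) (e j))
       - n * t * w
       + n * t * w powr (3 / 2) * exp (\<phi> q) * H (exp (\<phi> q) *\<^sub>R q))"

definition exterior_ball_condition :: "'n::finite lspace set \<Rightarrow> bool" where
  "exterior_ball_condition \<Omega> \<longleftrightarrow>
     (\<exists>\<sigma>>0. \<exists>\<Xi>. C2_map_on (hyp_top frontier_of \<Omega>) \<Xi> \<and>
       (\<forall>q0 \<in> hyp_top frontier_of \<Omega>.
          \<Xi> q0 \<in> hyperbolic - hyp_top closure_of \<Omega> \<and>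
          q0 \<in> hyp_top frontier_of (geodesic_ball (\<Xi> q0) \<sigma>) \<and>
          geodesic_ball (\<Xi> q0) \<sigma> \<subseteq> hyperbolic - hyp_top closure_of \<Omega>))"

definition admissible :: "'n::finite lspace set \<Rightarrow> ('n lspace \<Rightarrow> real) \<Rightarrow> bool" where
  "admissible \<Omega> H \<longleftrightarrow>
     (\<exists>\<theta>. 0 < \<theta> \<and> \<theta> < 1 \<and>
       (\<forall>q0 \<in> hyp_top frontier_of \<Omega>. \<forall>t\<in>{0..1}. \<exists>\<phi>1 \<phi>2.
          C2_closure \<Omega> \<phi>1 \<and> C2_closure \<Omega> \<phi>2 \<and>
          (\<forall>q\<in>\<Omega>. gnorm (hyp_grad \<phi>1 q) \<le> 1 - \<theta>) \<and>
          (\<forall>q\<in>\<Omega>. gnorm (hyp_grad \<phi>2 q) \<le> 1 - \<theta>) \<and>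
          \<phi>1 q0 = 0 \<and> (\<forall>q \<in> hyp_top frontier_of \<Omega>. \<phi>1 q \<le> 0) \<and>
          \<phi>2 q0 = 0 \<and> (\<forall>q \<in> hyp_top frontier_of \<Omega>. \<phi>2 q \<ge> 0) \<and>
          (\<forall>q\<in>\<Omega>. \<forall>e. orthonormal_frame q e \<longrightarrow> Qop H t \<phi>1 q e \<ge> 0) \<and>
          (\<forall>q\<in>\<Omega>. \<forall>e. orthonormal_frame q e \<longrightarrow> Qop H t \<phi>2 q e \<le> 0)))"

end

theory Submission
  imports Defs
begin

text \<open>
  Let \<open>r\<close> be the distance to the centre \<open>\<xi>\<close> of an exterior ball of radius \<open>\<sigma>\<close> touching
  \<open>\<partial>\<Omega>\<close> at \<open>q\<^sub>0\<close>.  For \<open>\<phi> = \<psi>(r)\<close> and \<open>w = 1 - \<psi>'\<^sup>2\<close>,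
  \<open>Q\<^sup>t(\<phi>) = \<psi>'' + (n-1) w \<psi>' coth r - n t w + n t w\<^bsup>3/2\<^esup> e\<^sup>\<phi> H(e\<^sup>\<phi> q)\<close>.
  The barriers are \<open>\<phi>\<^sub>2 = \<psi>(r)\<close> and \<open>\<phi>\<^sub>1 = - \<psi>(r)\<close> with \<open>\<psi>(\<sigma>) = 0\<close> and
  \<open>\<psi>' = tanh (C (R - r))\<close>, so that \<open>\<psi>'' = - C w\<close>, where \<open>R\<close> bounds \<open>r\<close> on the closure of \<open>\<Omega>\<close>
  uniformly in \<open>q\<^sub>0\<close>.  As \<open>\<psi> \<ge> 0\<close> outside the ball, monotonicity gives
  \<open>e\<^sup>\<phi> H(e\<^sup>\<phi> q) \<le> H(q) \<le> M\<close> for \<open>\<phi>\<^sub>2\<close>, while for \<open>\<phi>\<^sub>1\<close> the term with \<open>H\<close> is simply nonnegative; all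
  remaining terms are multiples of \<open>w\<close> and are dominated by \<open>C w\<close> for
  \<open>C = (n-1) coth \<sigma> + n M + n\<close>.  In the hyperboloid model \<open>cosh r = - lorentz \<xi> q\<close>.
\<close>

section \<open>The Lorentz form, the hyperboloid and its tangent spaces\<close>

lemma lorentz_inner: "lorentz x y = fst x \<bullet> fst y - snd x * snd y"
  by (simp add: lorentz_def inner_vec_def)

text \<open>Flipping the sign of the last coordinate of \<open>y\<close> turns the form into the
  Euclidean inner product. The interpretation below then supplies linearity, continuity and product
  rules for \<open>lorentz\<close>.\<close>

lemma bounded_bilinear_lorentz: "bounded_bilinear lorentz"
proof -
  have "bounded_bilinear (\<lambda>x y :: 'n::finite lspace. x \<bullet> (fst y, - snd y))"
    by (rule bounded_bilinear.comp[OF bounded_bilinear_inner bounded_linear_ident])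
      (intro bounded_linear_Pair bounded_linear_fst bounded_linear_minus bounded_linear_snd)
  also have "(\<lambda>x y :: 'n::finite lspace. x \<bullet> (fst y, - snd y)) = lorentz"
    by (auto simp: fun_eq_iff lorentz_inner inner_prod_def)
  finally show ?thesis .
qed

interpretation lorentz: bounded_bilinear lorentz
  by (rule bounded_bilinear_lorentz)

lemmas lorentz_simps = lorentz.add_left lorentz.add_right lorentz.diff_left lorentz.diff_right
  lorentz.scaleR_left lorentz.scaleR_right lorentz.minus_left lorentz.minus_right

lemma lorentz_commute: "lorentz x y = lorentz y x"
  by (simp add: lorentz_inner inner_commute mult.commute)

lemma timelike_norm_less:
  assumes "lorentz x x < 0" "snd x > 0"
  shows "norm (fst x) < snd x"
proof -
  have "(norm (fst x))\<^sup>2 < (snd x)\<^sup>2"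
    using assms(1) by (simp add: lorentz_inner dot_square_norm power2_eq_square)
  thus ?thesis
    using assms(2) by (simp add: power2_less_imp_less)
qed

lemma hyperbolicD:
  assumes "p \<in> hyperbolic"
  shows "lorentz p p = - 1" "snd p > 0" "norm (fst p) < snd p"
  using assms timelike_norm_less[of p] by (auto simp: hyperbolic_def)

lemma timelike_lorentz_neg:
  assumes "lorentz x x < 0" "snd x > 0" "lorentz y y < 0" "snd y > 0"
  shows "lorentz x y < 0"
proof -
  have "fst x \<bullet> fst y \<le> norm (fst x) * norm (fst y)"
    by (rule norm_cauchy_schwarz)
  also have "\<dots> < snd x * snd y"
    using timelike_norm_less[OF assms(1,2)] timelike_norm_less[OF assms(3,4)]
    using assms(2) by (intro mult_strict_mono) auto
  finally show ?thesis
    by (simp add: lorentz_inner)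
qed

text \<open>Tangency reads \<open>snd p * snd v = fst p \<bullet> fst v\<close>. As
  \<open>norm (fst p) < snd p\<close>, Cauchy-Schwarz on the spatial parts forces
  \<open>\<bar>snd v\<bar> < norm (fst v)\<close> unless \<open>fst v = 0\<close>.\<close>

lemma tangent_lorentz_pos:
  assumes "p \<in> hyperbolic" "v \<in> tangent p" "v \<noteq> 0"
  shows "lorentz v v > 0"
proof (cases "fst v = 0")
  case True
  hence "snd p * snd v = 0"
    using assms(2) by (simp add: tangent_def lorentz_inner)
  with True have "v = 0"
    using hyperbolicD[OF assms(1)] by (simp add: prod_eq_iff)
  thus ?thesis
    using assms(3) by simp
next
  case False
  have "snd p * snd v = fst p \<bullet> fst v"
    using assms(2) by (simp add: tangent_def lorentz_inner)
  hence "snd p * \<bar>snd v\<bar> \<le> norm (fst p) * norm (fst v)"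
    using Cauchy_Schwarz_ineq2[of "fst p" "fst v"] hyperbolicD(2)[OF assms(1)]
    by (metis abs_mult abs_of_pos)
  also have "\<dots> < snd p * norm (fst v)"
    using hyperbolicD[OF assms(1)] False by simp
  finally have "\<bar>snd v\<bar> < norm (fst v)"
    using hyperbolicD(2)[OF assms(1)] by simp
  hence "(snd v)\<^sup>2 < (norm (fst v))\<^sup>2"
    by (metis abs_ge_zero power2_abs power_strict_mono zero_less_numeral)
  thus ?thesis
    by (simp add: lorentz_inner dot_square_norm power2_eq_square)
qed

lemma tangent_lorentz_nonneg:
  assumes "p \<in> hyperbolic" "v \<in> tangent p"
  shows "lorentz v v \<ge> 0"
  using tangent_lorentz_pos[OF assms] by (cases "v = 0") (auto simp: lorentz_inner)

text \<open>The form is indefinite on the ambient space, so the classical argument is repeated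
  inside the tangent space: \<open>w\<close> is a multiple of the component of \<open>u\<close>
  orthogonal to \<open>v\<close>.\<close>

lemma tangent_cauchy_schwarz:
  assumes "p \<in> hyperbolic" "u \<in> tangent p" "v \<in> tangent p"
  shows "(lorentz u v)\<^sup>2 \<le> lorentz u u * lorentz v v"
proof (cases "v = 0")
  case True
  thus ?thesis
    by (simp add: lorentz.zero_right)
next
  case False
  define w where "w = lorentz v v *\<^sub>R u - lorentz u v *\<^sub>R v"
  have pos: "lorentz v v > 0"
    using tangent_lorentz_pos[OF assms(1,3) False] .
  have "w \<in> tangent p"
    using assms(2,3) by (simp add: w_def tangent_def lorentz_simps)
  hence "0 \<le> lorentz w w"
    by (rule tangent_lorentz_nonneg[OF assms(1)])
  also have "lorentz w w = lorentz v v * (lorentz u u * lorentz v v - (lorentz u v)\<^sup>2)"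
    by (simp add: w_def lorentz_simps lorentz_commute[of v u] algebra_simps power2_eq_square)
  finally show ?thesis
    using pos by (simp add: zero_le_mult_iff)
qed

lemma tangent_projection:
  assumes "p \<in> hyperbolic"
  shows "x + lorentz x p *\<^sub>R p \<in> tangent p"
  using hyperbolicD[OF assms] by (simp add: tangent_def lorentz_simps lorentz_commute)

text \<open>The tangential part of \<open>q\<close> at \<open>p\<close> has squared length
  \<open>(lorentz p q)\<^sup>2 - 1\<close>, which is therefore nonnegative; the sign is fixed
  because both points are future-directed. This puts \<open>- lorentz p q\<close> in the domain of
  \<open>arcosh\<close>.\<close>

lemma hyperbolic_lorentz_le:
  assumes "p \<in> hyperbolic" "q \<in> hyperbolic"
  shows "- lorentz p q \<ge> 1"
proof -
  have "0 \<le> lorentz (q + lorentz q p *\<^sub>R p) (q + lorentz q p *\<^sub>R p)"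
    by (rule tangent_lorentz_nonneg[OF assms(1) tangent_projection[OF assms(1)]])
  also have "\<dots> = (lorentz p q)\<^sup>2 - 1"
    using hyperbolicD(1)[OF assms(1)] hyperbolicD(1)[OF assms(2)]
    by (simp add: lorentz_simps lorentz_commute[of q p] power2_eq_square)
  finally have "1\<^sup>2 \<le> (- lorentz p q)\<^sup>2"
    by simp
  moreover have "- lorentz p q > 0"
    using timelike_lorentz_neg[of p q] hyperbolicD[OF assms(1)] hyperbolicD[OF assms(2)] by simp
  ultimately show ?thesis
    by (intro power2_le_imp_le[of 1]) auto
qed

text \<open>In the equality case \<open>q - p\<close> is the tangential part of \<open>q\<close> at
  \<open>p\<close> and a null vector, so definiteness on the tangent space makes it zero.\<close>

lemma hyperbolic_eq_iff:
  assumes "p \<in> hyperbolic" "q \<in> hyperbolic"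
  shows "p = q \<longleftrightarrow> lorentz p q = - 1"
proof
  assume *: "lorentz p q = - 1"
  have "lorentz p (q + lorentz q p *\<^sub>R p) = 0"
    using tangent_projection[OF assms(1)] by (simp add: tangent_def)
  hence tan: "q - p \<in> tangent p"
    using * by (simp add: tangent_def lorentz_commute)
  have "lorentz (q - p) (q - p) = 0"
    using * hyperbolicD(1)[OF assms(1)] hyperbolicD(1)[OF assms(2)]
    by (simp add: lorentz_simps lorentz_commute)
  thus "p = q"
    using tangent_lorentz_pos[OF assms(1) tan] by fastforce
qed (use hyperbolicD[OF assms(1)] in simp)

lemma closed_hyperbolic: "closed (hyperbolic :: 'n::finite lspace set)"
proof -
  \<comment> \<open>The weak inequality cuts out the same set, since \<open>snd x = 0\<close> would
    make \<open>lorentz x x\<close> nonnegative; the right-hand side is visibly closed.\<close>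
  have eq: "(hyperbolic :: 'n lspace set) = {x. lorentz x x = - 1} \<inter> {x. 0 \<le> snd x}"
    unfolding hyperbolic_def
  proof (intro equalityI subsetI, goal_cases)
    case (2 x)
    thus ?case
      by (cases "snd x = 0") (auto simp: lorentz_inner, smt (verit) inner_ge_zero)
  qed auto
  show ?thesis
    unfolding eq
    by (intro closed_Int closed_Collect_eq closed_Collect_le lorentz.continuous_on continuous_intros)
qed

text \<open>On the hyperboloid \<open>snd p - norm (fst p)\<close> is the reciprocal of
  \<open>snd p + norm (fst p)\<close>, hence at least \<open>1 / (2 * snd p)\<close>. Together with
  \<open>lorentz_le_snd\<close> this translates between hyperbolic distances and heights
  \<open>snd q\<close>.\<close>

lemma snd_le_lorentz:
  assumes "p \<in> hyperbolic" "q \<in> hyperbolic"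
  shows "snd q \<le> 2 * snd p * (- lorentz p q)"
proof -
  note P = hyperbolicD[OF assms(1)] and Q = hyperbolicD[OF assms(2)]
  have "norm (fst p) * norm (fst q) \<le> norm (fst p) * snd q"
    using Q by (intro mult_left_mono) auto
  hence 1: "(snd p - norm (fst p)) * snd q \<le> - lorentz p q"
    using norm_cauchy_schwarz[of "fst p" "fst q"] by (simp add: lorentz_inner algebra_simps)
  have "1 = (snd p + norm (fst p)) * (snd p - norm (fst p))"
    using P(1) by (simp add: lorentz_inner dot_square_norm power2_eq_square algebra_simps)
  also have "\<dots> \<le> 2 * snd p * (snd p - norm (fst p))"
    using P by (intro mult_right_mono) auto
  finally have "1 * snd q \<le> 2 * snd p * (snd p - norm (fst p)) * snd q"
    using Q by (intro mult_right_mono) auto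
  also have "\<dots> \<le> 2 * snd p * (- lorentz p q)"
    using mult_left_mono[OF 1, of "2 * snd p"] P by (simp add: mult.assoc)
  finally show ?thesis
    by simp
qed

lemma lorentz_le_snd:
  assumes "p \<in> hyperbolic" "q \<in> hyperbolic"
  shows "- lorentz p q \<le> 2 * snd p * snd q"
proof -
  note P = hyperbolicD[OF assms(1)] and Q = hyperbolicD[OF assms(2)]
  have "norm (fst p) * norm (fst q) \<le> snd p * snd q"
    using P Q by (intro mult_mono) auto
  moreover have "- (fst p \<bullet> fst q) \<le> norm (fst p) * norm (fst q)"
    using Cauchy_Schwarz_ineq2[of "fst p" "fst q"] by linarith
  ultimately show ?thesis
    by (simp add: lorentz_inner)
qed

text \<open>For \<open>v = \<gamma>'(s)\<close>, \<open>q = \<gamma>(s)\<close>: the function \<open>arcosh (- lorentz p \<gamma>)\<close> is \<open>1\<close>-Lipschitz.\<close>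

lemma lorentz_le_gnorm:
  assumes "p \<in> hyperbolic" "q \<in> hyperbolic" "v \<in> tangent q"
  shows "\<bar>lorentz p v\<bar> \<le> sqrt ((lorentz p q)\<^sup>2 - 1) * gnorm v"
proof -
  define u where "u = p + lorentz p q *\<^sub>R q"
  have u: "u \<in> tangent q"
    unfolding u_def by (rule tangent_projection[OF assms(2)])
  have "lorentz u v = lorentz p v"
    using assms(3) by (simp add: u_def lorentz_simps tangent_def)
  moreover have "lorentz u u = (lorentz p q)\<^sup>2 - 1"
    using hyperbolicD(1)[OF assms(1)] hyperbolicD(1)[OF assms(2)]
    by (simp add: u_def lorentz_simps lorentz_commute[of q p] power2_eq_square)
  ultimately have "(lorentz p v)\<^sup>2 \<le> ((lorentz p q)\<^sup>2 - 1) * lorentz v v"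
    using tangent_cauchy_schwarz[OF assms(2) u assms(3)] by simp
  hence "sqrt ((lorentz p v)\<^sup>2) \<le> sqrt (((lorentz p q)\<^sup>2 - 1) * lorentz v v)"
    by (rule real_sqrt_le_mono)
  thus ?thesis
    by (simp add: gnorm_def real_sqrt_mult)
qed

text \<open>The frame and \<open>q\<close> form a basis of the ambient space: pairing with
  \<open>e j\<close> and \<open>q\<close> recovers the coordinates, so \<open>T\<close> is
  injective, and equality of dimensions makes it surjective. A tangent vector has no
  \<open>q\<close>-component.\<close>

lemma orthonormal_frame_parseval:
  fixes q :: "'n::finite lspace"
  assumes "q \<in> hyperbolic" "orthonormal_frame q e" "u \<in> tangent q"
  shows "(\<Sum>i\<in>UNIV. (lorentz u (e i))\<^sup>2) = lorentz u u"
proof -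
  define T :: "'n lspace \<Rightarrow> 'n lspace"
    where "T x = (\<Sum>i\<in>UNIV. (fst x $ i) *\<^sub>R e i) + snd x *\<^sub>R q" for x
  have e: "lorentz q (e i) = 0" "lorentz (e i) q = 0" "lorentz (e i) (e j) = (if i = j then 1 else 0)" for i j
    using assms(2) lorentz_commute[of q] by (auto simp: orthonormal_frame_def tangent_def)
  have Te: "lorentz (T x) (e j) = fst x $ j" for x j
    by (simp add: T_def lorentz_simps lorentz.sum_left e if_distrib cong: if_cong)
  have Tq: "lorentz (T x) q = - snd x" for x
    using hyperbolicD(1)[OF assms(1)]
    by (simp add: T_def lorentz_simps lorentz.sum_left e)
  have lin: "linear T"
    by (intro linearI)
      (simp_all add: T_def scaleR_add_left sum.distrib scaleR_sum_right scaleR_add_right)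
  have "inj T"
  proof (rule injI)
    fix x y assume "T x = T y"
    hence "fst x $ j = fst y $ j" for j
      using Te[of x j] Te[of y j] by simp
    moreover have "snd x = snd y"
      using Tq[of x] Tq[of y] \<open>T x = T y\<close> by simp
    ultimately show "x = y"
      by (simp add: prod_eq_iff vec_eq_iff)
  qed
  hence "surj T"
    using lin linear_injective_imp_surjective by blast
  then obtain x where x: "u = T x"
    by (rule surjE)
  have "snd x = 0"
    using assms(3) Tq[of x] by (simp add: x tangent_def lorentz_commute)
  hence "lorentz u u = lorentz (\<Sum>i\<in>UNIV. (fst x $ i) *\<^sub>R e i) u"
    by (subst (1) x) (simp add: T_def)
  also have "\<dots> = (\<Sum>i\<in>UNIV. (lorentz u (e i))\<^sup>2)"
    using Te[of x] by (simp add: lorentz.scaleR_left lorentz.sum_left x[symmetric]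
        lorentz_commute[of "e _" u] power2_eq_square)
  finally show ?thesis ..
qed

section \<open>Lengths of curves, geodesics and the Riemannian distance\<close>

lemma tangent_of_path_in_hyperbolic:
  assumes "\<And>t. t \<in> {a<..<b} \<Longrightarrow> \<gamma> t \<in> hyperbolic" "t \<in> {a<..<b}"
    and "(\<gamma> has_vector_derivative v) (at t)"
  shows "v \<in> tangent (\<gamma> t)"
proof -
  have "((\<lambda>t. lorentz (\<gamma> t) (\<gamma> t)) has_vector_derivative lorentz (\<gamma> t) v + lorentz v (\<gamma> t)) (at t)"
    by (rule lorentz.has_vector_derivative[OF assms(3) assms(3)])
  moreover have "((\<lambda>t. lorentz (\<gamma> t) (\<gamma> t)) has_vector_derivative 0) (at t)"
  proof (rule has_vector_derivative_transform_within_open[where S = "{a<..<b}" and f = "\<lambda>_. - 1"])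
    show "- 1 = lorentz (\<gamma> x) (\<gamma> x)" if "x \<in> {a<..<b}" for x
      using hyperbolicD(1)[OF assms(1)[OF that]] by simp
  qed (use assms(2) in auto)
  ultimately have "lorentz (\<gamma> t) v + lorentz v (\<gamma> t) = 0"
    by (rule vector_derivative_unique_at)
  thus ?thesis
    by (simp add: tangent_def lorentz_commute[of v])
qed

text \<open>The function \<open>arcosh\<close> is not differentiable at \<open>1\<close>, the value at the starting point; shifting its
  argument by \<open>\<epsilon> > 0\<close> keeps the Lipschitz bound and removes the singularity.\<close>

lemma arcosh_le_length:
  fixes \<gamma> :: "real \<Rightarrow> 'n::finite lspace"
  assumes "valid_path \<gamma>" "path_image \<gamma> \<subseteq> hyperbolic" "pathstart \<gamma> = p" "pathfinish \<gamma> = q"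
    and L: "((\<lambda>s. gnorm (vector_derivative \<gamma> (at s))) has_integral L) {0..1}"
  shows "arcosh (- lorentz p q) \<le> L"
proof -
  have hyp: "\<gamma> t \<in> hyperbolic" if "t \<in> {0..1}" for t
    using assms(2) that by (auto simp: path_image_def)
  have p: "p \<in> hyperbolic" and q: "q \<in> hyperbolic"
    using hyp[of 0] hyp[of 1] assms(3,4) by (auto simp: pathstart_def pathfinish_def)
  obtain S D where S: "finite S" and cont: "continuous_on {0..1} \<gamma>"
    and D: "\<And>t. t \<in> {0..1} - S \<Longrightarrow> (\<gamma> has_vector_derivative D t) (at t)"
    using assms(1) unfolding valid_path_def piecewise_C1_differentiable_on_def
      C1_differentiable_on_def by blast
  let ?y = "\<lambda>t. - lorentz p (\<gamma> t)"
  have y: "?y t \<ge> 1" if "t \<in> {0..1}" for t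
    using hyperbolic_lorentz_le[OF p hyp[OF that]] .
  have le: "arcosh (- lorentz p q + \<epsilon>) - arcosh (1 + \<epsilon>) \<le> L" if "\<epsilon> > 0" for \<epsilon>
  proof -
    define f where "f t = arcosh (?y t + \<epsilon>)" for t
    \<comment> \<open>At the endpoints and break points, finitely many, \<open>f'\<close> is given
      the speed of the curve itself; the fundamental theorem ignores them and the comparison with
      the speed is trivial there.\<close>
    define f' where "f' t = (if t \<in> {0<..<1} - S
      then - lorentz p (D t) / sqrt ((?y t + \<epsilon>)\<^sup>2 - 1) else gnorm (vector_derivative \<gamma> (at t)))" for t
    have "(f' has_integral (f 1 - f 0)) {0..1}"
    proof (rule fundamental_theorem_of_calculus_interior_strong[OF S])
      fix t assume t: "t \<in> {0<..<1} - S"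
      have "(\<gamma> has_vector_derivative D t) (at t)"
        using t by (intro D) auto
      hence "((\<lambda>t. lorentz p (\<gamma> t)) has_vector_derivative lorentz p (D t)) (at t)"
        by (rule bounded_linear.has_vector_derivative[OF lorentz.bounded_linear_right])
      hence *: "((\<lambda>t. lorentz p (\<gamma> t)) has_real_derivative lorentz p (D t)) (at t)"
        by (simp add: has_real_derivative_iff_has_vector_derivative)
      have "((\<lambda>t. ?y t + \<epsilon>) has_real_derivative - lorentz p (D t)) (at t)"
        by (auto intro!: derivative_eq_intros *)
      from DERIV_chain2[OF arcosh_real_has_field_derivative this]
      have "(f has_real_derivative f' t) (at t)"
        using t y[of t] that by (simp add: f_def[abs_def] f'_def)
      thus "(f has_vector_derivative f' t) (at t)"
        by (simp add: has_real_derivative_iff_has_vector_derivative)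
    next
      show "continuous_on {0..1} f"
        unfolding f_def using y that
        by (intro continuous_intros lorentz.continuous_on cont) force
    qed auto
    hence "f 1 - f 0 \<le> L"
    proof (rule has_integral_le[OF _ L])
      fix t :: real assume "t \<in> {0..1}"
      show "f' t \<le> gnorm (vector_derivative \<gamma> (at t))"
      proof (cases "t \<in> {0<..<1} - S")
        case True
        hence t: "t \<in> {0..1}" and der: "(\<gamma> has_vector_derivative D t) (at t)"
          using D by auto
        have "D t \<in> tangent (\<gamma> t)"
          using hyp True by (intro tangent_of_path_in_hyperbolic[OF _ _ der, of 0 1]) auto
        hence "\<bar>lorentz p (D t)\<bar> \<le> sqrt ((lorentz p (\<gamma> t))\<^sup>2 - 1) * gnorm (D t)"
          and "gnorm (D t) \<ge> 0"
          using lorentz_le_gnorm[OF p hyp[OF t]] tangent_lorentz_nonneg[OF hyp[OF t]]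
          by (auto simp: gnorm_def)
        moreover have "(lorentz p (\<gamma> t))\<^sup>2 \<le> (?y t + \<epsilon>)\<^sup>2"
          using y[OF t] that power_mono[of "?y t" "?y t + \<epsilon>" 2] by simp
        ultimately have "- lorentz p (D t) \<le> sqrt ((?y t + \<epsilon>)\<^sup>2 - 1) * gnorm (D t)"
          using mult_right_mono[of "sqrt ((lorentz p (\<gamma> t))\<^sup>2 - 1)" "sqrt ((?y t + \<epsilon>)\<^sup>2 - 1)"
              "gnorm (D t)"] by simp
        moreover have "sqrt ((?y t + \<epsilon>)\<^sup>2 - 1) > 0"
          using y[OF t] that by simp
        ultimately have "- lorentz p (D t) / sqrt ((?y t + \<epsilon>)\<^sup>2 - 1) \<le> gnorm (D t)"
          by (subst pos_divide_le_eq) (auto simp: mult.commute)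
        hence "f' t \<le> gnorm (D t)"
          using True by (simp add: f'_def)
        thus ?thesis
          using der by (simp add: vector_derivative_at)
      qed (auto simp: f'_def)
    qed
    thus ?thesis
      using assms(3,4) hyperbolicD(1)[OF p] by (simp add: f_def pathstart_def pathfinish_def add.commute)
  qed
  \<comment> \<open>Only continuity of \<open>arcosh\<close> from the right at \<open>1\<close> is
    used to let \<epsilon> tend to \<open>0\<close>.\<close>
  have "((\<lambda>\<epsilon>. arcosh (- lorentz p q + \<epsilon>) - arcosh (1 + \<epsilon>)) \<longlongrightarrow>
      arcosh (- lorentz p q + 0) - arcosh (1 + 0)) (at_right (0 :: real))"
    using hyperbolic_lorentz_le[OF p q]
    by (intro tendsto_diff tendsto_arcosh_strong tendsto_intros)
      (auto simp: eventually_at_right_field intro!: exI[of _ 1])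
  hence "arcosh (- lorentz p q + 0) - arcosh (1 + 0) \<le> L"
    by (rule tendsto_upperbound) (use le in \<open>auto simp: eventually_at_right_field intro!: exI[of _ 1]\<close>)
  thus ?thesis
    by simp
qed

text \<open>With \<open>a = r * (1 - t)\<close> and \<open>b = r * t\<close> the first identity
  keeps the geodesic constructed next on the hyperboloid, and the second makes its speed the
  constant \<open>r\<close>.\<close>

lemma sinh_sinh_cosh_add:
  fixes a b :: real
  shows "(sinh a)\<^sup>2 + (sinh b)\<^sup>2 + 2 * sinh a * sinh b * cosh (a + b) = (sinh (a + b))\<^sup>2"
    "2 * cosh a * cosh b * cosh (a + b) - (cosh a)\<^sup>2 - (cosh b)\<^sup>2 = (sinh (a + b))\<^sup>2"
  using cosh_square_eq[of a] cosh_square_eq[of b] unfolding sinh_add cosh_add by algebra+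

text \<open>The lower bound of \<open>arcosh_le_length\<close> is attained, so the infimum defining
  \<open>hyp_dist\<close> is a minimum.\<close>

lemma length_of_geodesic:
  fixes p q :: "'n::finite lspace"
  assumes "p \<in> hyperbolic" "q \<in> hyperbolic"
  shows "\<exists>\<gamma>. valid_path \<gamma> \<and> path_image \<gamma> \<subseteq> hyperbolic \<and> pathstart \<gamma> = p \<and> pathfinish \<gamma> = q \<and>
    ((\<lambda>s. gnorm (vector_derivative \<gamma> (at s))) has_integral arcosh (- lorentz p q)) {0..1}"
\<comment> \<open>Equal points get the constant path, because the weights of the geodesic divide by
  \<open>sinh r\<close>.\<close>
proof (cases "p = q")
  case True
  have "vector_derivative (\<lambda>_ :: real. p) (at s) = 0" for s
    by (intro vector_derivative_at has_vector_derivative_const)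
  hence "((\<lambda>s. gnorm (vector_derivative (\<lambda>_. p) (at s))) has_integral 0) {0..1}"
    by (simp add: gnorm_def lorentz.zero_left)
  moreover have "valid_path (\<lambda>_. p)"
    unfolding valid_path_def by (intro C1_differentiable_imp_piecewise) auto
  ultimately show ?thesis
    using True assms hyperbolicD(1)[OF assms(1)]
    by (intro exI[of _ "\<lambda>_. p"]) (auto simp: path_image_def pathstart_def pathfinish_def)
next
  case False
  note P = hyperbolicD[OF assms(1)] and Q = hyperbolicD[OF assms(2)]
  define s where "s = - lorentz p q"
  define r where "r = arcosh s"
  have "s \<ge> 1" "s \<noteq> 1"
    using hyperbolic_lorentz_le[OF assms] hyperbolic_eq_iff[OF assms] False by (auto simp: s_def)
  hence s: "s > 1" and r: "r > 0" and s_r: "lorentz p q = - cosh r" "lorentz q p = - cosh r"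
    by (auto simp: r_def s_def lorentz_commute[of q])
  have sinh: "sinh r > 0"
    using r by simp
  \<comment> \<open>The hyperbolic analogue of spherical linear interpolation between
    \<open>p\<close> and \<open>q\<close>.\<close>
  define \<gamma> where "\<gamma> t = (sinh (r * (1 - t)) / sinh r) *\<^sub>R p + (sinh (r * t) / sinh r) *\<^sub>R q" for t
  define \<gamma>' where "\<gamma>' t = (- r * cosh (r * (1 - t)) / sinh r) *\<^sub>R p + (r * cosh (r * t) / sinh r) *\<^sub>R q" for t
  have der: "(\<gamma> has_vector_derivative \<gamma>' t) (at t)" for t
  proof -
    have "((\<lambda>t. sinh (r * (1 - t)) / sinh r) has_real_derivative
        - r * cosh (r * (1 - t)) / sinh r) (at t)"
      and "((\<lambda>t. sinh (r * t) / sinh r) has_real_derivative r * cosh (r * t) / sinh r) (at t)"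
      using sinh by (auto intro!: derivative_eq_intros)
    thus ?thesis
      unfolding \<gamma>_def \<gamma>'_def
      using has_vector_derivative_scaleR[OF _ has_vector_derivative_const]
      by (fastforce intro: has_vector_derivative_add)
  qed
  have "(sinh (r * (1 - t)))\<^sup>2 + (sinh (r * t))\<^sup>2 + 2 * sinh (r * (1 - t)) * sinh (r * t) * cosh r = (sinh r)\<^sup>2"
    "2 * cosh (r * (1 - t)) * cosh (r * t) * cosh r - (cosh (r * (1 - t)))\<^sup>2 - (cosh (r * t))\<^sup>2 = (sinh r)\<^sup>2" for t
    using sinh_sinh_cosh_add[of "r * (1 - t)" "r * t"] by (simp_all add: algebra_simps)
  note id = this
  have "lorentz (\<gamma> t) (\<gamma> t) = - ((sinh (r * (1 - t)))\<^sup>2 + (sinh (r * t))\<^sup>2 +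
     2 * sinh (r * (1 - t)) * sinh (r * t) * cosh r) / (sinh r)\<^sup>2" for t
    using sinh P(1) Q(1) unfolding \<gamma>_def
    by (simp add: lorentz_simps s_r field_simps power2_eq_square)
  hence norm1: "lorentz (\<gamma> t) (\<gamma> t) = - 1" for t
    unfolding id using sinh by simp
  have "lorentz (\<gamma>' t) (\<gamma>' t) = r\<^sup>2 * (2 * cosh (r * (1 - t)) * cosh (r * t) * cosh r -
      (cosh (r * (1 - t)))\<^sup>2 - (cosh (r * t))\<^sup>2) / (sinh r)\<^sup>2" for t
    using sinh P(1) Q(1) unfolding \<gamma>'_def
    by (simp add: lorentz_simps s_r field_simps power2_eq_square)
  hence speed: "gnorm (\<gamma>' t) = r" for t
    unfolding id using sinh r by (simp add: gnorm_def)
  have "snd (\<gamma> t) > 0" if "t \<in> {0..1}" for t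
  proof (cases "t = 0")
    case False
    thus ?thesis
      using that r sinh P Q unfolding \<gamma>_def snd_add snd_scaleR
      by (intro add_nonneg_pos) auto
  qed (use P sinh in \<open>simp add: \<gamma>_def\<close>)
  hence "path_image \<gamma> \<subseteq> hyperbolic"
    using norm1 by (auto simp: path_image_def hyperbolic_def)
  moreover have "valid_path \<gamma>"
    unfolding valid_path_def
  proof (intro C1_differentiable_imp_piecewise)
    show "\<gamma> C1_differentiable_on {0..1}"
      unfolding C1_differentiable_on_def
    proof (intro exI[of _ \<gamma>'] conjI ballI der)
      show "continuous_on {0..1} \<gamma>'"
        unfolding \<gamma>'_def using sinh by (intro continuous_intros) auto
    qed
  qed
  moreover have "((\<lambda>t. gnorm (vector_derivative \<gamma> (at t))) has_integral r) {0..1}"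
    using has_integral_const_real[of r 0 1] vector_derivative_at[OF der] speed by simp
  moreover have "pathstart \<gamma> = p" "pathfinish \<gamma> = q"
    using sinh by (simp_all add: \<gamma>_def pathstart_def pathfinish_def)
  ultimately show ?thesis
    unfolding r_def s_def by blast
qed

lemma hyp_dist_eq:
  assumes "p \<in> hyperbolic" "q \<in> hyperbolic"
  shows "hyp_dist p q = arcosh (- lorentz p q)"
  unfolding hyp_dist_def
proof (rule cInf_eq_minimum)
  show "arcosh (- lorentz p q) \<in> {L. \<exists>\<gamma>. valid_path \<gamma> \<and> path_image \<gamma> \<subseteq> hyperbolic \<and>
      pathstart \<gamma> = p \<and> pathfinish \<gamma> = q \<and>
      ((\<lambda>s. gnorm (vector_derivative \<gamma> (at s))) has_integral L) {0..1}}"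
    using length_of_geodesic[OF assms] by blast
qed (use arcosh_le_length in blast)

lemma hyp_dist_less_iff:
  assumes "p \<in> hyperbolic" "q \<in> hyperbolic" "\<sigma> > 0"
  shows "hyp_dist p q < \<sigma> \<longleftrightarrow> - lorentz p q < cosh \<sigma>"
proof -
  have "arcosh (- lorentz p q) < arcosh (cosh \<sigma>) \<longleftrightarrow> - lorentz p q < cosh \<sigma>"
    using hyperbolic_lorentz_le[OF assms(1,2)] cosh_real_ge_1 by (intro arcosh_less_iff_real)
  thus ?thesis
    using assms by (simp add: hyp_dist_eq arcosh_cosh_real)
qed

section \<open>A criterion for second-order regularity and the derivatives of the radial
  projection\<close>

lemma C2_uptoI:
  fixes f :: "'a::euclidean_space \<Rightarrow> real"
  assumes "S \<subseteq> A"
    and d1: "\<And>x. x \<in> A \<Longrightarrow> (f has_derivative f' x) (at x)"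
    and d2: "\<And>x v. x \<in> A \<Longrightarrow> ((\<lambda>x. f' x v) has_derivative f'' x v) (at x)"
    and c2: "\<And>v w. continuous_on A (\<lambda>x. f'' x v w)"
  shows "C2_upto S A f"
proof -
  \<comment> \<open>Expanding the derivative along \<open>Basis\<close> reduces differentiability
    and continuity of the operator-valued maps to those of the scalar functions in the
    hypotheses.\<close>
  define D where "D x = (\<Sum>b\<in>Basis. f' x b *\<^sub>R blinfun_inner_left b)" for x
  define D' where "D' x w = (\<Sum>b\<in>Basis. f'' x b w *\<^sub>R blinfun_inner_left b)" for x and w :: 'a
  have D: "blinfun_apply (D x) = f' x" if "x \<in> A" for x
  proof
    fix v :: 'a
    interpret linear "f' x"
      using has_derivative_linear[OF d1[OF that]] .
    have "f' x v = f' x (\<Sum>b\<in>Basis. (v \<bullet> b) *\<^sub>R b)"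
      by (simp add: euclidean_representation)
    also have "\<dots> = D x v"
      by (simp add: sum scale D_def blinfun.sum_left blinfun.scaleR_left inner_commute mult.commute)
    finally show "D x v = f' x v" ..
  qed
  have D': "(D has_derivative D' x) (at x)" if "x \<in> A" for x
    unfolding D_def[abs_def] D'_def[abs_def]
    by (intro has_derivative_sum has_derivative_scaleR_left d2 that)
  hence bl: "bounded_linear (D' x)" if "x \<in> A" for x
    using has_derivative_bounded_linear that by blast
  show ?thesis
    unfolding C2_upto_def C1_upto_def
  proof (intro conjI exI[of _ D] exI[of _ "\<lambda>x. Blinfun (D' x)"] ballI)
    show "continuous_on A f"
      using d1 by (auto intro!: continuous_at_imp_continuous_on has_derivative_continuous)
    show "continuous_on A D"
      using D' by (auto intro!: continuous_at_imp_continuous_on has_derivative_continuous)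
    show "(f has_derivative blinfun_apply (D x)) (at x)" if "x \<in> S" for x
      using d1 D that assms(1) by auto
    show "(D has_derivative blinfun_apply (Blinfun (D' x))) (at x)" if "x \<in> S" for x
      using D' bl that assms(1) by (auto simp: bounded_linear_Blinfun_apply)
    show "continuous_on A (\<lambda>x. Blinfun (D' x))"
    proof (rule continuous_on_blinfun_componentwise)
      fix w :: 'a
      have "continuous_on A (\<lambda>x. D' x w)"
        unfolding D'_def by (intro continuous_intros c2)
      also have "?this \<longleftrightarrow> continuous_on A (\<lambda>x. Blinfun (D' x) w)"
        by (rule continuous_on_cong) (simp_all only: bl bounded_linear_Blinfun_apply)
      finally show "continuous_on A (\<lambda>x. Blinfun (D' x) w)" .
    qed
  qed
qed

text \<open>The open cone of future timelike vectors: a neighbourhood of the hyperboloid on which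
  \<open>radial\<close> is smooth, so that ambient derivatives can be taken.\<close>

definition future :: "'n::finite lspace set" where
  "future = {x. lorentz x x < 0 \<and> snd x > 0}"

lemma futureD:
  assumes "x \<in> future"
  shows "lorentz x x < 0" "snd x > 0" "sqrt (- lorentz x x) > 0"
  using assms by (auto simp: future_def)

lemma open_future: "open (future :: 'n::finite lspace set)"
  unfolding future_def
  by (intro open_Collect_conj open_Collect_less lorentz.continuous_on continuous_intros)

lemma hyperbolic_subset_future: "hyperbolic \<subseteq> future"
  by (auto simp: hyperbolic_def future_def)

lemma radial_in_hyperbolic:
  assumes "x \<in> future"
  shows "radial x \<in> hyperbolic"
proof -
  have "lorentz (radial x) (radial x) = - 1"
    using futureD[OF assms] by (simp add: radial_def lorentz_simps field_simps)
  moreover have "snd (radial x) > 0"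
    using futureD[OF assms] by (simp add: radial_def)
  ultimately show ?thesis
    by (simp add: hyperbolic_def)
qed

lemma radial_hyperbolic: "p \<in> hyperbolic \<Longrightarrow> radial p = p"
  by (simp add: radial_def hyperbolicD)

lemma scaleR_hyperbolic_in_future: "p \<in> hyperbolic \<Longrightarrow> \<rho> > 0 \<Longrightarrow> \<rho> *\<^sub>R p \<in> future"
  by (simp add: future_def lorentz_simps hyperbolicD)

lemma radial_scaleR_hyperbolic:
  assumes "p \<in> hyperbolic" "\<rho> > 0"
  shows "radial (\<rho> *\<^sub>R p) = p"
  using assms hyperbolicD(1)[OF assms(1)]
  by (simp add: radial_def lorentz_simps real_sqrt_mult)

definition lorentz_norm :: "'n::finite lspace \<Rightarrow> real" where
  "lorentz_norm x = sqrt (- lorentz x x)"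

text \<open>The derivative of \<open>radial\<close> at \<open>x\<close> in the direction
  \<open>v\<close>; \<open>radial''\<close> differentiates it once more, in the direction
  \<open>w\<close>, with \<open>v\<close> fixed.\<close>

definition radial' :: "'n::finite lspace \<Rightarrow> 'n lspace \<Rightarrow> 'n lspace" where
  "radial' x v = v /\<^sub>R lorentz_norm x + (lorentz x v / lorentz_norm x ^ 3) *\<^sub>R x"

definition radial'' :: "'n::finite lspace \<Rightarrow> 'n lspace \<Rightarrow> 'n lspace \<Rightarrow> 'n lspace" where
  "radial'' x v w = (lorentz x w / lorentz_norm x ^ 3) *\<^sub>R v +
     (lorentz w v / lorentz_norm x ^ 3 + 3 * lorentz x v * lorentz x w / lorentz_norm x ^ 5) *\<^sub>R x +
     (lorentz x v / lorentz_norm x ^ 3) *\<^sub>R w"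

lemma lorentz_norm_pos: "x \<in> future \<Longrightarrow> lorentz_norm x > 0"
  by (simp add: lorentz_norm_def future_def)

lemma lorentz_norm_has_derivative:
  assumes "x \<in> future"
  shows "(lorentz_norm has_derivative (\<lambda>v. - lorentz x v / lorentz_norm x)) (at x)"
proof -
  have "((\<lambda>x. - lorentz x x) has_derivative (\<lambda>v. - (lorentz x v + lorentz v x))) (at x)"
    by (intro has_derivative_minus lorentz.FDERIV has_derivative_ident)
  from has_derivative_real_sqrt[OF _ this] show ?thesis
    using futureD[OF assms] lorentz_norm_pos[OF assms]
    by (simp add: lorentz_norm_def[abs_def] lorentz_commute field_simps)
qed

lemma inverse_lorentz_norm_has_derivative:
  assumes "x \<in> future"
  shows "((\<lambda>x. inverse (lorentz_norm x)) has_derivative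
    (\<lambda>v. lorentz x v / lorentz_norm x ^ 3)) (at x)"
  using lorentz_norm_pos[OF assms]
  by (auto intro!: derivative_eq_intros lorentz_norm_has_derivative[OF assms]
      simp: fun_eq_iff field_simps power3_eq_cube)

lemma radial_has_derivative:
  assumes "x \<in> future"
  shows "(radial has_derivative radial' x) (at x)"
proof -
  have "((\<lambda>x. x /\<^sub>R lorentz_norm x) has_derivative
      (\<lambda>v. v /\<^sub>R lorentz_norm x + (lorentz x v / lorentz_norm x ^ 3) *\<^sub>R x)) (at x)"
    by (intro has_derivative_scaleR inverse_lorentz_norm_has_derivative assms has_derivative_ident)
  thus ?thesis
    by (simp add: radial_def[abs_def] radial'_def[abs_def] lorentz_norm_def)
qed

lemma radial'_has_derivative:
  assumes "x \<in> future"
  shows "((\<lambda>x. radial' x v) has_derivative radial'' x v) (at x)"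
proof -
  have 1: "((\<lambda>x. lorentz x v) has_derivative (\<lambda>w. lorentz w v)) (at x)"
    by (rule bounded_linear.has_derivative[OF lorentz.bounded_linear_left has_derivative_ident])
  have 2: "((\<lambda>x. lorentz x v / lorentz_norm x ^ 3) has_derivative
      (\<lambda>w. lorentz w v / lorentz_norm x ^ 3 +
       3 * lorentz x v * lorentz x w / lorentz_norm x ^ 5)) (at x)"
  proof -
    have "((\<lambda>x. lorentz x v * inverse (lorentz_norm x) ^ 3) has_derivative
        (\<lambda>w. lorentz x v * (of_nat 3 * (lorentz x w / lorentz_norm x ^ 3) * inverse (lorentz_norm x) ^ (3 - 1))
          + lorentz w v * inverse (lorentz_norm x) ^ 3)) (at x)"
      by (intro has_derivative_mult 1 has_derivative_power inverse_lorentz_norm_has_derivative assms)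
    thus ?thesis
      by (simp add: divide_inverse power_inverse algebra_simps eval_nat_numeral)
  qed
  have "((\<lambda>x. radial' x v) has_derivative (\<lambda>w. (lorentz x w / lorentz_norm x ^ 3) *\<^sub>R v +
      ((lorentz x v / lorentz_norm x ^ 3) *\<^sub>R w +
      (lorentz w v / lorentz_norm x ^ 3 +
       3 * lorentz x v * lorentz x w / lorentz_norm x ^ 5) *\<^sub>R x))) (at x)"
    unfolding radial'_def
    by (intro has_derivative_add has_derivative_scaleR_left inverse_lorentz_norm_has_derivative
        has_derivative_scaleR[OF 2 has_derivative_ident] assms)
  thus ?thesis
    by (simp add: radial''_def[abs_def] add_ac)
qed

lemma continuous_on_radial'': "continuous_on future (\<lambda>x. radial'' x v w)"
  unfolding radial''_def lorentz_norm_def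
  by (intro continuous_intros lorentz.continuous_on) (auto simp: future_def)

section \<open>Functions of the distance to a point: gradient, Hessian and the operator\<close>

text \<open>A radial function \<open>\<phi> = K(s)\<close> with \<open>s = - lorentz \<xi> q = cosh r\<close>, where \<open>r\<close> is the distance
  to \<open>\<xi>\<close>.  Since \<open>s\<close> is the restriction of a linear function, its Hessian is \<open>s g\<close>.\<close>

locale radial_profile =
  fixes \<xi> :: "'n::finite lspace" and K K' K'' :: "real \<Rightarrow> real"
  assumes \<xi>: "\<xi> \<in> hyperbolic"
    and K: "\<And>s. s > 1 \<Longrightarrow> (K has_real_derivative K' s) (at s)"
    and K': "\<And>s. s > 1 \<Longrightarrow> (K' has_real_derivative K'' s) (at s)"
    and K'': "continuous_on {1<..} K''"
begin

text \<open>The function \<open>cosh r\<close> extended constantly along rays, the form in which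
  \<open>hyp_deriv\<close> differentiates it.\<close>

definition ht :: "'n lspace \<Rightarrow> real" where
  "ht x = - lorentz \<xi> (radial x)"

definition \<phi> :: "'n lspace \<Rightarrow> real" where
  "\<phi> q = K (- lorentz \<xi> q)"

text \<open>Leaves out the ray through \<xi>, where \<open>ht\<close> equals \<open>1\<close> and
  the profile is not assumed differentiable.\<close>

definition punctured :: "'n lspace set" where
  "punctured = {x \<in> future. ht x > 1}"

lemma ht_has_derivative:
  assumes "x \<in> future"
  shows "(ht has_derivative (\<lambda>v. - lorentz \<xi> (radial' x v))) (at x)"
  unfolding ht_def[abs_def]
  by (intro derivative_intros bounded_linear.has_derivative[OF lorentz.bounded_linear_right]
      radial_has_derivative assms)

lemma continuous_on_ht: "continuous_on future ht"
  using ht_has_derivative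
  by (auto intro!: continuous_at_imp_continuous_on has_derivative_continuous)

lemma open_punctured: "open punctured"
proof -
  have "punctured = ht -` {1<..} \<inter> future"
    by (auto simp: punctured_def)
  thus ?thesis
    using continuous_open_preimage[OF continuous_on_ht open_future open_greaterThan, of 1]
    by (simp add: Int_commute)
qed

lemma K_ht_has_derivative:
  assumes "x \<in> punctured"
  shows "((\<lambda>x. K (ht x)) has_derivative (\<lambda>v. K' (ht x) * (- lorentz \<xi> (radial' x v)))) (at x)"
    and "((\<lambda>x. K' (ht x)) has_derivative (\<lambda>v. K'' (ht x) * (- lorentz \<xi> (radial' x v)))) (at x)"
proof -
  have x: "x \<in> future" "ht x > 1"
    using assms by (auto simp: punctured_def)
  show "((\<lambda>x. K (ht x)) has_derivative (\<lambda>v. K' (ht x) * (- lorentz \<xi> (radial' x v)))) (at x)"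
    using has_derivative_compose[OF ht_has_derivative[OF x(1)]
        K[OF x(2), unfolded has_field_derivative_def]] by simp
  show "((\<lambda>x. K' (ht x)) has_derivative (\<lambda>v. K'' (ht x) * (- lorentz \<xi> (radial' x v)))) (at x)"
    using has_derivative_compose[OF ht_has_derivative[OF x(1)]
        K'[OF x(2), unfolded has_field_derivative_def]] by simp
qed

lemma \<phi>_radial: "\<phi> (radial x) = K (ht x)"
  by (simp add: \<phi>_def ht_def)

lemma C2_upto_\<phi>:
  assumes "S \<subseteq> A" "A \<subseteq> punctured"
  shows "C2_upto S A (\<lambda>x. \<phi> (radial x))"
proof (rule C2_uptoI[OF assms(1)])
  fix x assume "x \<in> A"
  hence x: "x \<in> punctured" "x \<in> future"
    using assms(2) by (auto simp: punctured_def)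
  show "((\<lambda>x. \<phi> (radial x)) has_derivative (\<lambda>v. K' (ht x) * (- lorentz \<xi> (radial' x v)))) (at x)"
    unfolding \<phi>_radial by (rule K_ht_has_derivative[OF x(1)])
  show "((\<lambda>x. K' (ht x) * (- lorentz \<xi> (radial' x v))) has_derivative
      (\<lambda>w. K' (ht x) * (- lorentz \<xi> (radial'' x v w)) +
        K'' (ht x) * (- lorentz \<xi> (radial' x w)) * (- lorentz \<xi> (radial' x v)))) (at x)" for v
    by (intro has_derivative_mult K_ht_has_derivative(2) x derivative_intros
        bounded_linear.has_derivative[OF lorentz.bounded_linear_right] radial'_has_derivative)
next
  have fut: "A \<subseteq> future" and pos: "ht ` A \<subseteq> {1<..}"
    using assms(2) by (auto simp: punctured_def)
  have K'c: "continuous_on {1<..} K'"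
    using K' by (auto intro!: continuous_at_imp_continuous_on DERIV_isCont)
  have rad': "continuous_on A (\<lambda>x. radial' x v)" for v
    using has_derivative_continuous[OF radial'_has_derivative] fut
    by (intro continuous_at_imp_continuous_on) blast
  have ht: "continuous_on A ht"
    using continuous_on_ht fut by (rule continuous_on_subset)
  show "continuous_on A (\<lambda>x. K' (ht x) * (- lorentz \<xi> (radial'' x v w)) +
      K'' (ht x) * (- lorentz \<xi> (radial' x w)) * (- lorentz \<xi> (radial' x v)))" for v w
    using continuous_on_compose2[OF K'c ht pos] continuous_on_compose2[OF K'' ht pos]
      continuous_on_subset[OF continuous_on_radial'' fut] rad'
    by (intro continuous_intros lorentz.continuous_on)
qed

lemma hyperbolic_punctured: "p \<in> hyperbolic \<Longrightarrow> - lorentz \<xi> p > 1 \<Longrightarrow> p \<in> punctured"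
  using hyperbolic_subset_future by (auto simp: punctured_def ht_def radial_hyperbolic)

text \<open>At a point of the hyperboloid \<open>radial\<close> has the tangential projection as
  derivative, so extending radially does not change derivatives in tangent directions.\<close>

lemma radial'_tangent:
  assumes "p \<in> hyperbolic" "v \<in> tangent p"
  shows "radial' p v = v"
  using assms by (simp add: radial'_def lorentz_norm_def hyperbolicD tangent_def)

lemma hyp_deriv_\<phi>:
  assumes "p \<in> hyperbolic" "- lorentz \<xi> p > 1" "v \<in> tangent p"
  shows "hyp_deriv \<phi> p v = - K' (- lorentz \<xi> p) * lorentz \<xi> v"
proof -
  have "((\<lambda>x. \<phi> (radial x)) has_derivative (\<lambda>v. K' (ht p) * (- lorentz \<xi> (radial' p v)))) (at p)"
    unfolding \<phi>_radial by (intro K_ht_has_derivative hyperbolic_punctured assms)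
  hence "hyp_deriv \<phi> p v = K' (ht p) * (- lorentz \<xi> (radial' p v))"
    unfolding hyp_deriv_def by (metis frechet_derivative_at)
  thus ?thesis
    using assms by (simp add: radial'_tangent ht_def radial_hyperbolic)
qed

text \<open>The vector multiplying \<open>K'\<close> is minus the tangential part of \<xi>, which is
  the gradient of \<open>- lorentz \<xi> p\<close>. Definiteness on the tangent space gives the
  uniqueness demanded by \<open>THE\<close>.\<close>

lemma hyp_grad_\<phi>:
  assumes "p \<in> hyperbolic" "- lorentz \<xi> p > 1"
  shows "hyp_grad \<phi> p = K' (- lorentz \<xi> p) *\<^sub>R (- \<xi> - lorentz \<xi> p *\<^sub>R p)"
  unfolding hyp_grad_def
proof (rule the_equality)
  let ?g = "K' (- lorentz \<xi> p) *\<^sub>R (- \<xi> - lorentz \<xi> p *\<^sub>R p)"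
  have tan: "?g \<in> tangent p"
    using hyperbolicD[OF assms(1)] by (simp add: tangent_def lorentz_simps lorentz_commute)
  have der: "lorentz ?g v = hyp_deriv \<phi> p v" if "v \<in> tangent p" for v
    using assms that by (simp add: hyp_deriv_\<phi> lorentz_simps tangent_def)
  show "?g \<in> tangent p \<and> (\<forall>v\<in>tangent p. lorentz ?g v = hyp_deriv \<phi> p v)"
    using tan der by blast
  fix w assume w: "w \<in> tangent p \<and> (\<forall>v\<in>tangent p. lorentz w v = hyp_deriv \<phi> p v)"
  have diff: "w - ?g \<in> tangent p"
    using w tan unfolding tangent_def by (simp add: lorentz.diff_right)
  hence "lorentz (w - ?g) (w - ?g) = 0"
    using w der by (simp add: lorentz.diff_left)
  thus "w = ?g"
    using tangent_lorentz_pos[OF assms(1) diff] by fastforce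
qed

lemma gnorm_hyp_grad_\<phi>:
  assumes "p \<in> hyperbolic" "- lorentz \<xi> p > 1"
  shows "(gnorm (hyp_grad \<phi> p))\<^sup>2 = (K' (- lorentz \<xi> p))\<^sup>2 * ((lorentz \<xi> p)\<^sup>2 - 1)"
proof -
  have "1\<^sup>2 \<le> (- lorentz \<xi> p)\<^sup>2"
    using assms by (intro power_mono) auto
  hence "(lorentz \<xi> p)\<^sup>2 \<ge> 1"
    by simp
  moreover have "lorentz (hyp_grad \<phi> p) (hyp_grad \<phi> p) = (K' (- lorentz \<xi> p))\<^sup>2 * ((lorentz \<xi> p)\<^sup>2 - 1)"
    using hyperbolicD(1)[OF assms(1)] hyperbolicD(1)[OF \<xi>]
    by (simp add: hyp_grad_\<phi>[OF assms] lorentz_simps lorentz_commute[of p \<xi>] power2_eq_square algebra_simps)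
  ultimately show ?thesis
    by (simp add: gnorm_def)
qed

lemma hyp_hess_\<phi>:
  assumes "p \<in> hyperbolic" "- lorentz \<xi> p > 1" "v \<in> tangent p" "w \<in> tangent p"
  shows "hyp_hess \<phi> p v w = K'' (- lorentz \<xi> p) * lorentz \<xi> v * lorentz \<xi> w
    + K' (- lorentz \<xi> p) * (- lorentz \<xi> p) * lorentz v w"
proof -
  let ?G = "\<lambda>x. K' (ht x) *\<^sub>R (- \<xi> + ht x *\<^sub>R radial x)"
  \<comment> \<open>\<open>?G\<close> is an explicit formula for the radially extended gradient;
    agreement on the open set \<open>punctured\<close> allows its derivative to be used for
    \<open>hyp_grad\<close>.\<close>
  have p: "p \<in> punctured" "p \<in> future"
    using hyperbolic_punctured[OF assms(1,2)] by (auto simp: punctured_def)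
  have eq: "?G x = hyp_grad \<phi> (radial x)" if "x \<in> punctured" for x
    using that radial_in_hyperbolic[of x] by (simp add: punctured_def ht_def hyp_grad_\<phi>)
  have "(?G has_derivative (\<lambda>v. K' (ht p) *\<^sub>R (0 + (ht p *\<^sub>R radial' p v + (- lorentz \<xi> (radial' p v)) *\<^sub>R radial p))
      + (K'' (ht p) * (- lorentz \<xi> (radial' p v))) *\<^sub>R (- \<xi> + ht p *\<^sub>R radial p))) (at p)"
    by (intro has_derivative_scaleR has_derivative_add has_derivative_const
        K_ht_has_derivative ht_has_derivative radial_has_derivative p)
  hence "((\<lambda>x. hyp_grad \<phi> (radial x)) has_derivative
      (\<lambda>v. K' (ht p) *\<^sub>R (0 + (ht p *\<^sub>R radial' p v + (- lorentz \<xi> (radial' p v)) *\<^sub>R radial p))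
      + (K'' (ht p) * (- lorentz \<xi> (radial' p v))) *\<^sub>R (- \<xi> + ht p *\<^sub>R radial p))) (at p)"
    using eq by (rule has_derivative_transform_within_open[OF _ open_punctured p(1)])
  hence "hyp_deriv (hyp_grad \<phi>) p v =
      K' (ht p) *\<^sub>R (ht p *\<^sub>R radial' p v + (- lorentz \<xi> (radial' p v)) *\<^sub>R radial p)
      + (K'' (ht p) * (- lorentz \<xi> (radial' p v))) *\<^sub>R (- \<xi> + ht p *\<^sub>R radial p)"
    unfolding hyp_deriv_def by (simp flip: frechet_derivative_at)
  hence "hyp_deriv (hyp_grad \<phi>) p v = K' (- lorentz \<xi> p) *\<^sub>R ((- lorentz \<xi> p) *\<^sub>R v - lorentz \<xi> v *\<^sub>R p)
      - (K'' (- lorentz \<xi> p) * lorentz \<xi> v) *\<^sub>R (- \<xi> - lorentz \<xi> p *\<^sub>R p)"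
    using assms by (simp add: radial'_tangent ht_def radial_hyperbolic)
  \<comment> \<open>Pairing with the tangent vector \<open>w\<close> kills all multiples of
    \<open>p\<close>, including the one added by \<open>cov_deriv\<close>.\<close>
  thus ?thesis
    using assms(4) unfolding hyp_hess_def cov_deriv_def
    by (simp add: lorentz_simps tangent_def)
qed

text \<open>In the frame both the coefficient matrix and the Hessian are combinations of the
  identity and of \<open>l i * l j\<close>, so the contraction depends only on the sum of the
  \<open>(l i)\<^sup>2\<close>.\<close>

lemma Qop_\<phi>:
  fixes p :: "'n lspace" and n :: real
  defines "s \<equiv> - lorentz \<xi> p" and "n \<equiv> real CARD('n)"
  defines "w \<equiv> 1 - (K' s)\<^sup>2 * (s\<^sup>2 - 1)"
  assumes "p \<in> hyperbolic" "s > 1" "orthonormal_frame p e"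
  shows "Qop H t \<phi> p e = K'' s * (s\<^sup>2 - 1) + K' s * s + (n - 1) * w * K' s * s
    - n * t * w + n * t * w powr (3 / 2) * exp (K s) * H (exp (K s) *\<^sub>R p)"
proof -
  have s1: "- lorentz \<xi> p > 1"
    using assms by simp
  have e: "e i \<in> tangent p" "lorentz (e i) (e j) = (if i = j then 1 else 0)" for i j
    using assms(6) by (auto simp: orthonormal_frame_def)
  define l where "l i = lorentz \<xi> (e i)" for i
  \<comment> \<open>Parseval needs a tangent vector, so it is applied to the tangential part of
    \<xi>, which has the same frame coefficients as \<xi>.\<close>
  have "(\<Sum>i\<in>UNIV. (lorentz (\<xi> + lorentz \<xi> p *\<^sub>R p) (e i))\<^sup>2) =
      lorentz (\<xi> + lorentz \<xi> p *\<^sub>R p) (\<xi> + lorentz \<xi> p *\<^sub>R p)"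
    by (rule orthonormal_frame_parseval[OF assms(4,6) tangent_projection[OF assms(4)]])
  moreover have "lorentz p (e i) = 0" for i
    using e by (simp add: tangent_def)
  ultimately have l2: "(\<Sum>i\<in>UNIV. (l i)\<^sup>2) = s\<^sup>2 - 1"
    using hyperbolicD(1)[OF assms(4)] hyperbolicD(1)[OF \<xi>]
    by (simp add: l_def s_def lorentz_simps lorentz_commute[of p \<xi>] power2_eq_square)
  have d: "hyp_deriv \<phi> p (e i) = - K' s * l i" for i
    using hyp_deriv_\<phi>[OF assms(4) s1 e(1)] by (simp add: s_def l_def)
  have h: "hyp_hess \<phi> p (e i) (e j) = K'' s * l i * l j + K' s * s * (if i = j then 1 else 0)" for i j
    using hyp_hess_\<phi>[OF assms(4) s1 e(1) e(1)] by (simp add: s_def l_def e)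
  have "(\<Sum>i\<in>UNIV. \<Sum>j\<in>UNIV. (w * (if i = j then 1 else 0) + hyp_deriv \<phi> p (e i) * hyp_deriv \<phi> p (e j))
            * hyp_hess \<phi> p (e i) (e j)) =
     (\<Sum>i\<in>UNIV. \<Sum>j\<in>UNIV. (if i = j then w * K'' s * (l i)\<^sup>2 + w * K' s * s + (K' s)\<^sup>2 * K' s * s * (l i)\<^sup>2 else 0)
        + (K' s)\<^sup>2 * K'' s * ((l i)\<^sup>2 * (l j)\<^sup>2))"
    unfolding d h by (intro sum.cong refl) (simp add: algebra_simps power2_eq_square)
  also have "\<dots> = (w * K'' s + (K' s)\<^sup>2 * K' s * s) * (\<Sum>i\<in>UNIV. (l i)\<^sup>2) + n * w * K' s * s
     + (K' s)\<^sup>2 * K'' s * ((\<Sum>i\<in>UNIV. (l i)\<^sup>2) * (\<Sum>i\<in>UNIV. (l i)\<^sup>2))"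
    by (simp add: sum.distrib sum_product sum_distrib_left sum_distrib_right n_def algebra_simps)
  \<comment> \<open>The relation \<open>w + (K' s)\<^sup>2 * (s\<^sup>2 - 1) = 1\<close> makes the
    coefficient of \<open>K''\<close> collapse and leaves one term \<open>K' s * s\<close> without
    the factor \<open>w\<close>.\<close>
  also have "\<dots> = K'' s * (s\<^sup>2 - 1) + K' s * s + (n - 1) * w * K' s * s"
    unfolding l2 w_def by algebra
  finally have sum: "(\<Sum>i\<in>UNIV. \<Sum>j\<in>UNIV. (w * (if i = j then 1 else 0) +
      hyp_deriv \<phi> p (e i) * hyp_deriv \<phi> p (e j)) * hyp_hess \<phi> p (e i) (e j)) =
    K'' s * (s\<^sup>2 - 1) + K' s * s + (n - 1) * w * K' s * s" .
  have w: "1 - (gnorm (hyp_grad \<phi> p))\<^sup>2 = w"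
    using gnorm_hyp_grad_\<phi>[OF assms(4) s1] by (simp add: w_def s_def)
  show ?thesis
    unfolding Qop_def Let_def w sum by (simp add: n_def \<phi>_def s_def)
qed

end

section \<open>The explicit barrier profile and its estimates\<close>

locale barrier =
  fixes \<xi> :: "'n::finite lspace" and \<sigma> R C \<epsilon> :: real
  assumes \<xi>_hyp: "\<xi> \<in> hyperbolic" and \<sigma>: "0 < \<sigma>" and R: "\<sigma> < R" and C: "0 < C"
    and \<epsilon>: "\<epsilon> \<in> {1, - 1}"
begin

text \<open>The derivative of the profile with respect to the distance \<open>r\<close>, written in
  the variable \<open>s = cosh r\<close>.\<close>

definition slope :: "real \<Rightarrow> real" where
  "slope s = tanh (C * (R - arcosh s))"

text \<open>The antiderivative of \<open>tanh (C * (R - r))\<close> in \<open>r\<close> that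
  vanishes at \<open>r = \<sigma>\<close>.\<close>

definition G :: "real \<Rightarrow> real" where
  "G s = (ln (cosh (C * (R - \<sigma>))) - ln (cosh (C * (R - arcosh s)))) / C"

text \<open>The denominator is \<open>sinh r\<close>, the derivative of \<open>s\<close> with
  respect to \<open>r\<close>.\<close>

definition G' :: "real \<Rightarrow> real" where
  "G' s = slope s / sqrt (s\<^sup>2 - 1)"

definition G'' :: "real \<Rightarrow> real" where
  "G'' s = (- C * (1 - (slope s)\<^sup>2) - slope s * s / sqrt (s\<^sup>2 - 1)) / (s\<^sup>2 - 1)"

lemma slope_has_derivative:
  assumes "s > 1"
  shows "(slope has_real_derivative - C * (1 - (slope s)\<^sup>2) / sqrt (s\<^sup>2 - 1)) (at s)"
proof -
  have "((\<lambda>s. C * (R - arcosh s)) has_real_derivative - C / sqrt (s\<^sup>2 - 1)) (at s)"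
    using assms by (auto intro!: derivative_eq_intros)
  from has_field_derivative_tanh[OF _ this] show ?thesis
    by (simp add: slope_def[abs_def] mult.commute)
qed

lemma G_has_derivative:
  assumes "s > 1"
  shows "(G has_real_derivative G' s) (at s)"
proof -
  have "((\<lambda>s. C * (R - arcosh s)) has_real_derivative - C / sqrt (s\<^sup>2 - 1)) (at s)"
    using assms by (auto intro!: derivative_eq_intros)
  from DERIV_chain2[OF DERIV_ln_divide has_field_derivative_cosh[OF this]]
  have "((\<lambda>s. ln (cosh (C * (R - arcosh s)))) has_real_derivative
      1 / cosh (C * (R - arcosh s)) * (sinh (C * (R - arcosh s)) * (- C / sqrt (s\<^sup>2 - 1)))) (at s)"
    by simp
  from DERIV_cdivide[OF DERIV_diff[OF DERIV_const this], of "ln (cosh (C * (R - \<sigma>)))" C]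
  show ?thesis
    using C by (simp add: G_def[abs_def] G'_def slope_def tanh_def)
qed

lemma G'_has_derivative:
  assumes "s > 1"
  shows "(G' has_real_derivative G'' s) (at s)"
proof -
  have pos: "s\<^sup>2 - 1 > 0"
    using assms by simp
  have "((\<lambda>s. s\<^sup>2 - 1) has_real_derivative 2 * s) (at s)"
    by (auto intro!: derivative_eq_intros)
  from DERIV_chain2[OF DERIV_real_sqrt[OF pos] this]
  have "((\<lambda>s. sqrt (s\<^sup>2 - 1)) has_real_derivative s / sqrt (s\<^sup>2 - 1)) (at s)"
    by (simp add: field_simps)
  from DERIV_divide[OF slope_has_derivative[OF assms] this]
  have "(G' has_real_derivative (- C * (1 - (slope s)\<^sup>2) / sqrt (s\<^sup>2 - 1) * sqrt (s\<^sup>2 - 1) -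
      slope s * (s / sqrt (s\<^sup>2 - 1))) / (sqrt (s\<^sup>2 - 1) * sqrt (s\<^sup>2 - 1))) (at s)"
    using pos by (simp add: G'_def[abs_def])
  thus ?thesis
    using pos by (simp add: G''_def)
qed

lemma continuous_on_G'': "continuous_on {1<..} G''"
proof -
  have "continuous_on {1<..} slope"
    using slope_has_derivative by (auto intro!: continuous_at_imp_continuous_on DERIV_isCont)
  thus ?thesis
    unfolding G''_def[abs_def]
    by (intro continuous_intros) (auto simp: one_less_power power2_eq_1_iff)
qed

text \<open>The sign \<epsilon> lets one computation serve both barriers: \<open>1\<close> gives the
  upper one and \<open>- 1\<close> the lower one.\<close>

sublocale radial_profile \<xi> "\<lambda>s. \<epsilon> * G s" "\<lambda>s. \<epsilon> * G' s" "\<lambda>s. \<epsilon> * G'' s"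
proof
  show "continuous_on {1<..} (\<lambda>s. \<epsilon> * G'' s)"
    by (intro continuous_on_mult_left continuous_on_G'')
qed (use \<xi>_hyp DERIV_cmult[OF G_has_derivative] DERIV_cmult[OF G'_has_derivative] in blast)+

text \<open>The slope at \<open>r = \<sigma>\<close>, its largest value for
  \<open>r \<ge> \<sigma>\<close>. It depends only on \<sigma>, \<open>R\<close> and
  \<open>C\<close>, so the gradient bound is uniform in the centre \<xi>.\<close>

definition slope_max :: real where
  "slope_max = tanh (C * (R - \<sigma>))"

lemma slope_max: "0 < slope_max" "slope_max < 1"
  using C R tanh_real_lt_1 by (simp_all add: slope_max_def)

text \<open>The closed shell \<sigma> \<le> \<open>r\<close> \<le> \<open>R\<close>, which will
  contain the closure of \<Omega>.\<close>

definition annulus :: "'n lspace set" where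
  "annulus = {p \<in> hyperbolic. cosh \<sigma> \<le> - lorentz \<xi> p \<and> - lorentz \<xi> p \<le> cosh R}"

lemma arcosh_range:
  assumes "cosh \<sigma> \<le> s" "s \<le> cosh R"
  shows "\<sigma> \<le> arcosh s" "arcosh s \<le> R" "s > 1"
proof -
  show s: "s > 1"
    using assms(1) cosh_real_strict_mono[of 0 \<sigma>] \<sigma> by simp
  have "cosh \<sigma> \<le> cosh (arcosh s)" "cosh (arcosh s) \<le> cosh R"
    using assms s by simp_all
  moreover have "arcosh s \<ge> 0"
    using s by simp
  ultimately show "\<sigma> \<le> arcosh s" "arcosh s \<le> R"
    using \<sigma> R by (simp_all add: cosh_real_nonneg_le_iff)
qed

lemma slope_range:
  assumes "cosh \<sigma> \<le> s" "s \<le> cosh R"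
  shows "0 \<le> slope s" "slope s \<le> slope_max"
  using arcosh_range[OF assms] C by (simp_all add: slope_def slope_max_def)

lemma G_nonneg:
  assumes "cosh \<sigma> \<le> s" "s \<le> cosh R"
  shows "0 \<le> G s"
proof -
  have "cosh (C * (R - arcosh s)) \<le> cosh (C * (R - \<sigma>))"
    using arcosh_range[OF assms] C R by (subst cosh_real_nonneg_le_iff) auto
  thus ?thesis
    using C by (simp add: G_def)
qed

lemma G_cosh_\<sigma>: "G (cosh \<sigma>) = 0"
  using \<sigma> by (simp add: G_def arcosh_cosh_real)

lemma annulusD:
  assumes "p \<in> annulus"
  shows "p \<in> hyperbolic" "cosh \<sigma> \<le> - lorentz \<xi> p" "- lorentz \<xi> p \<le> cosh R" "- lorentz \<xi> p > 1"
proof -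
  show p: "p \<in> hyperbolic" "cosh \<sigma> \<le> - lorentz \<xi> p" "- lorentz \<xi> p \<le> cosh R"
    using assms by (simp_all add: annulus_def)
  show "- lorentz \<xi> p > 1"
    using arcosh_range(3)[OF p(2,3)] .
qed

lemma \<epsilon>_square: "\<epsilon>\<^sup>2 = 1"
  using \<epsilon> by auto

lemma G'_square: "s > 1 \<Longrightarrow> (G' s)\<^sup>2 * (s\<^sup>2 - 1) = (slope s)\<^sup>2"
  by (simp add: G'_def power_divide power2_eq_1_iff)

lemma gnorm_hyp_grad_le:
  assumes "p \<in> annulus"
  shows "gnorm (hyp_grad \<phi> p) \<le> slope_max"
proof -
  let ?s = "- lorentz \<xi> p"
  note p = annulusD[OF assms]
  have "(gnorm (hyp_grad \<phi> p))\<^sup>2 = (\<epsilon> * G' ?s)\<^sup>2 * (?s\<^sup>2 - 1)"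
    unfolding gnorm_hyp_grad_\<phi>[OF p(1,4)] power2_minus ..
  also have "\<dots> = (slope ?s)\<^sup>2"
    unfolding power_mult_distrib \<epsilon>_square mult_1_left by (rule G'_square[OF p(4)])
  finally have "gnorm (hyp_grad \<phi> p) \<le> slope ?s"
    by (rule power2_le_imp_le[OF eq_refl slope_range(1)[OF p(2,3)]])
  thus ?thesis
    using slope_range(2)[OF p(2,3)] by (rule order_trans)
qed

lemma \<phi>_sign:
  assumes "p \<in> annulus"
  shows "0 \<le> \<epsilon> * \<phi> p"
proof -
  have "\<epsilon> * \<phi> p = \<epsilon>\<^sup>2 * G (- lorentz \<xi> p)"
    by (simp add: \<phi>_def power2_eq_square)
  thus ?thesis
    using G_nonneg[OF annulusD(2,3)[OF assms]] by (simp add: \<epsilon>_square)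
qed

lemma \<phi>_eq_0: "- lorentz \<xi> p = cosh \<sigma> \<Longrightarrow> \<phi> p = 0"
  by (simp add: \<phi>_def G_cosh_\<sigma>)

lemma C2_closure_\<phi>:
  assumes "hyp_top closure_of \<Omega> \<subseteq> annulus" "\<Omega> \<subseteq> hyp_top closure_of \<Omega>"
  shows "C2_closure \<Omega> \<phi>"
  unfolding C2_closure_def
proof (rule C2_upto_\<phi>)
  show "cone_over \<Omega> \<subseteq> cone_over (hyp_top closure_of \<Omega>)"
    using assms(2) by (auto simp: cone_over_def)
  show "cone_over (hyp_top closure_of \<Omega>) \<subseteq> punctured"
  proof
    fix x assume "x \<in> cone_over (hyp_top closure_of \<Omega>)"
    then obtain \<rho> q where x: "x = \<rho> *\<^sub>R q" "q \<in> annulus" "\<rho> > 0"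
      using assms(1) by (auto simp: cone_over_def)
    thus "x \<in> punctured"
      using annulusD[OF x(2)]
      by (simp add: punctured_def ht_def scaleR_hyperbolic_in_future radial_scaleR_hyperbolic)
  qed
qed

text \<open>This is the monotonicity of coth: after squaring and clearing denominators it reduces to
  \<open>(cosh \<sigma>)\<^sup>2 \<le> s\<^sup>2\<close>.\<close>

lemma coth_bound:
  assumes "cosh \<sigma> \<le> s"
  shows "s / sqrt (s\<^sup>2 - 1) \<le> cosh \<sigma> / sinh \<sigma>"
proof -
  have sinh: "sinh \<sigma> > 0"
    using \<sigma> by simp
  have s: "s > 1"
    using assms cosh_real_strict_mono[of 0 \<sigma>] \<sigma> by simp
  have "(cosh \<sigma>)\<^sup>2 \<le> s\<^sup>2"
    using assms by (intro power_mono) auto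
  hence "(s * sinh \<sigma>)\<^sup>2 \<le> (cosh \<sigma>)\<^sup>2 * (s\<^sup>2 - 1)"
    by (simp add: power_mult_distrib cosh_square_eq algebra_simps)
  also have "\<dots> = (cosh \<sigma> * sqrt (s\<^sup>2 - 1))\<^sup>2"
    using s by (simp add: power_mult_distrib)
  finally have "s * sinh \<sigma> \<le> cosh \<sigma> * sqrt (s\<^sup>2 - 1)"
    using s by (auto intro: power2_le_imp_le)
  thus ?thesis
    using sinh s by (simp add: divide_simps mult.commute)
qed

text \<open>The coth term inside \<open>G''\<close> cancels \<open>G' s * s\<close>, the one term of
  \<open>Qop_\<phi>\<close> without a factor \<open>w\<close>; what remains of the second derivative
  is \<open>- C * w\<close>.\<close>

lemma Qop_barrier:
  fixes p :: "'n lspace" and n :: real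
  defines "s \<equiv> - lorentz \<xi> p" and "n \<equiv> real CARD('n)"
  defines "w \<equiv> 1 - (slope s)\<^sup>2"
  assumes "p \<in> annulus" "orthonormal_frame p e"
  shows "Qop H t \<phi> p e = \<epsilon> * w * ((n - 1) * (slope s * (s / sqrt (s\<^sup>2 - 1))) - C)
    - n * t * w + n * t * w powr (3 / 2) * exp (\<phi> p) * H (exp (\<phi> p) *\<^sub>R p)"
proof -
  note p = annulusD[OF assms(4)]
  have s: "s > 1"
    using p(4) by (simp add: s_def)
  have pos: "s\<^sup>2 - 1 > 0"
    using one_less_power[OF s, of 2] by simp
  have w: "1 - (\<epsilon> * G' s)\<^sup>2 * (s\<^sup>2 - 1) = w"
    using G'_square[OF s] by (simp add: w_def power_mult_distrib \<epsilon>_square)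
  define X where "X = slope s * (s / sqrt (s\<^sup>2 - 1))"
  have G's: "G' s * s = X"
    by (simp add: G'_def X_def)
  have G''s: "G'' s * (s\<^sup>2 - 1) = - C * w - X"
    using pos by (simp add: G''_def w_def X_def)
  have "\<epsilon> * G'' s * (s\<^sup>2 - 1) + \<epsilon> * G' s * s + (n - 1) * w * (\<epsilon> * G' s) * s =
      \<epsilon> * (G'' s * (s\<^sup>2 - 1)) + \<epsilon> * (G' s * s) + (n - 1) * w * \<epsilon> * (G' s * s)"
    by (simp only: mult.assoc)
  also have "\<dots> = \<epsilon> * w * ((n - 1) * X - C)"
    unfolding G's G''s by (simp add: algebra_simps)
  finally have "\<epsilon> * G'' s * (s\<^sup>2 - 1) + \<epsilon> * G' s * s + (n - 1) * w * (\<epsilon> * G' s) * s =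
      \<epsilon> * w * ((n - 1) * X - C)" .
  moreover have "Qop H t \<phi> p e = \<epsilon> * G'' s * (s\<^sup>2 - 1) + \<epsilon> * G' s * s + (n - 1) * w * (\<epsilon> * G' s) * s
      - n * t * w + n * t * w powr (3 / 2) * exp (\<epsilon> * G s) * H (exp (\<epsilon> * G s) *\<^sub>R p)"
    using Qop_\<phi>[OF p(1,4) assms(5), of H t] unfolding s_def[symmetric] n_def[symmetric] w .
  ultimately show ?thesis
    unfolding \<phi>_def s_def[symmetric] X_def by simp
qed

lemma slope_square_less_1:
  assumes "cosh \<sigma> \<le> s" "s \<le> cosh R"
  shows "0 < 1 - (slope s)\<^sup>2"
proof -
  have "(slope s)\<^sup>2 < 1"
    using slope_range[OF assms] slope_max by (intro power_less_one_iff[THEN iffD2]) auto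
  thus ?thesis
    by simp
qed

lemma slope_coth_bound:
  assumes "cosh \<sigma> \<le> s" "s \<le> cosh R"
  shows "slope s * (s / sqrt (s\<^sup>2 - 1)) \<le> cosh \<sigma> / sinh \<sigma>"
proof -
  have "slope s * (s / sqrt (s\<^sup>2 - 1)) \<le> 1 * (s / sqrt (s\<^sup>2 - 1))"
    using slope_range[OF assms] slope_max arcosh_range(3)[OF assms]
    by (intro mult_right_mono divide_nonneg_nonneg) auto
  thus ?thesis
    using coth_bound[OF assms(1)] by linarith
qed

text \<open>Since \<open>0 < w \<le> 1\<close>, \<open>w powr (3 / 2) \<le> w\<close>, so the term
  with \<open>H\<close> is at most \<open>n * M * w\<close>. The part \<open>- C * w\<close> absorbs
  it and the coth term, while \<open>- n * t * w\<close> has the right sign.\<close>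

lemma Qop_supersolution:
  fixes p :: "'n lspace" and n :: real
  defines "n \<equiv> real CARD('n)"
  assumes "\<epsilon> = 1" "p \<in> annulus" "orthonormal_frame p e" "0 \<le> t" "t \<le> 1" "0 \<le> M"
    and M: "exp (\<phi> p) * H (exp (\<phi> p) *\<^sub>R p) \<le> M"
    and C: "(n - 1) * (cosh \<sigma> / sinh \<sigma>) + n * M \<le> C"
  shows "Qop H t \<phi> p e \<le> 0"
proof -
  define s where "s = - lorentz \<xi> p"
  define w where "w = 1 - (slope s)\<^sup>2"
  define c where "c = slope s * (s / sqrt (s\<^sup>2 - 1))"
  note range = annulusD(2,3)[OF assms(3), folded s_def]
  have w: "0 < w" "w \<le> 1"
    using slope_square_less_1[OF range] by (auto simp: w_def)
  have n: "n \<ge> 1"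
    by (simp add: n_def Suc_leI)
  have eq: "\<epsilon> * w * ((n - 1) * c - C) = w * ((n - 1) * c) - w * C"
    using assms(2) by (simp add: right_diff_distrib)
  have "w powr (3 / 2) \<le> w powr 1"
    using w by (intro powr_mono') auto
  hence "n * t * w powr (3 / 2) \<le> n * 1 * w"
    using w n assms(5,6) by (intro mult_mono) auto
  hence "n * t * w powr (3 / 2) * (exp (\<phi> p) * H (exp (\<phi> p) *\<^sub>R p)) \<le> n * 1 * w * M"
    using n w assms(5,7) by (intro order_trans[OF mult_left_mono[OF M] mult_right_mono]) simp_all
  moreover have "w * ((n - 1) * c) \<le> w * ((n - 1) * (cosh \<sigma> / sinh \<sigma>))"
    using slope_coth_bound[OF range] w n by (intro mult_left_mono) (auto simp: c_def)
  moreover have "w * ((n - 1) * (cosh \<sigma> / sinh \<sigma>)) + n * 1 * w * M \<le> w * C"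
    using mult_left_mono[OF C, of w] w by (simp add: distrib_left mult_ac)
  moreover have "n * t * w \<ge> 0"
    using n w assms(5) by simp
  moreover have "Qop H t \<phi> p e = w * ((n - 1) * c) - w * C - n * t * w
      + n * t * w powr (3 / 2) * (exp (\<phi> p) * H (exp (\<phi> p) *\<^sub>R p))"
    unfolding Qop_barrier[OF assms(3,4), folded s_def, folded n_def c_def w_def] eq
    by (simp only: mult.assoc)
  ultimately show ?thesis
    by linarith
qed

text \<open>The signs of the second-order terms are reversed: now \<open>C * w\<close> has to absorb
  the coth term and \<open>n * t * w\<close>, and the term with \<open>H\<close> helps.\<close>

lemma Qop_subsolution:
  fixes p :: "'n lspace" and n :: real
  defines "n \<equiv> real CARD('n)"
  assumes "\<epsilon> = - 1" "p \<in> annulus" "orthonormal_frame p e" "0 \<le> t" "t \<le> 1"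
    and H: "0 \<le> H (exp (\<phi> p) *\<^sub>R p)"
    and C: "(n - 1) * (cosh \<sigma> / sinh \<sigma>) + n \<le> C"
  shows "0 \<le> Qop H t \<phi> p e"
proof -
  define s where "s = - lorentz \<xi> p"
  define w where "w = 1 - (slope s)\<^sup>2"
  define c where "c = slope s * (s / sqrt (s\<^sup>2 - 1))"
  note range = annulusD(2,3)[OF assms(3), folded s_def]
  have w: "0 < w" "w \<le> 1"
    using slope_square_less_1[OF range] by (auto simp: w_def)
  have n: "n \<ge> 1"
    by (simp add: n_def Suc_leI)
  have eq: "\<epsilon> * w * ((n - 1) * c - C) = w * C - w * ((n - 1) * c)"
    using assms(2) by (simp add: right_diff_distrib)
  have "w * ((n - 1) * c) \<le> w * ((n - 1) * (cosh \<sigma> / sinh \<sigma>))"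
    using slope_coth_bound[OF range] w n by (intro mult_left_mono) (auto simp: c_def)
  moreover have "w * ((n - 1) * (cosh \<sigma> / sinh \<sigma>)) + n * 1 * w \<le> w * C"
    using mult_left_mono[OF C, of w] w by (simp add: distrib_left mult_ac)
  moreover have "n * t * w \<le> n * 1 * w"
    using n w assms(6) by (intro mult_right_mono mult_left_mono) auto
  moreover have "n * t * w powr (3 / 2) * exp (\<phi> p) * H (exp (\<phi> p) *\<^sub>R p) \<ge> 0"
    using n assms(5) H by (intro mult_nonneg_nonneg) auto
  moreover have "Qop H t \<phi> p e = w * C - w * ((n - 1) * c) - n * t * w
      + n * t * w powr (3 / 2) * exp (\<phi> p) * H (exp (\<phi> p) *\<^sub>R p)"
    unfolding Qop_barrier[OF assms(3,4), folded s_def, folded n_def c_def w_def] eq ..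
  ultimately show ?thesis
    by linarith
qed

end

section \<open>Relative closures, geodesic spheres, compactness and monotonicity along rays\<close>

lemma hyp_closure_subset:
  fixes \<Omega> :: "'n::finite lspace set"
  assumes "closed S" "\<Omega> \<subseteq> hyperbolic" "\<Omega> \<subseteq> S"
  shows "hyp_top closure_of \<Omega> \<subseteq> S"
proof -
  have "hyp_top closure_of \<Omega> \<subseteq> hyperbolic \<inter> S"
    using assms by (intro closure_of_minimal closedin_closed_Int) auto
  thus ?thesis
    by simp
qed

text \<open>The ball is relatively open, so a frontier point lies outside it; as a limit of the ball
  it also satisfies the weak inequality.\<close>

lemma frontier_of_geodesic_ball:
  fixes \<xi> :: "'n::finite lspace"
  assumes "\<xi> \<in> hyperbolic" "\<sigma> > 0" "q \<in> hyp_top frontier_of (geodesic_ball \<xi> \<sigma>)"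
  shows "- lorentz \<xi> q = cosh \<sigma>"
proof -
  let ?B = "geodesic_ball \<xi> \<sigma>"
  have B: "?B = hyperbolic \<inter> {x. - lorentz \<xi> x < cosh \<sigma>}"
    using hyp_dist_less_iff[OF assms(1) _ assms(2)] by (auto simp: geodesic_ball_def)
  have "openin hyp_top ?B"
    unfolding B by (intro openin_open_Int open_Collect_less lorentz.continuous_on continuous_intros)
  hence q: "q \<in> hyp_top closure_of ?B" "q \<notin> ?B"
    using assms(3) by (simp_all add: frontier_of_def interior_of_openin)
  have "hyp_top closure_of ?B \<subseteq> {x. - lorentz \<xi> x \<le> cosh \<sigma>}"
    by (intro hyp_closure_subset closed_Collect_le lorentz.continuous_on continuous_intros)
      (auto simp: B)
  moreover have "q \<in> hyperbolic"
    using q(1) closure_of_subset_topspace[of hyp_top ?B] by auto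
  ultimately show ?thesis
    using q by (auto simp: B)
qed

lemma hyp_bounded_imp_snd_bounded:
  fixes \<Omega> :: "'n::finite lspace set"
  assumes "hyp_bounded \<Omega>" "\<Omega> \<subseteq> hyperbolic"
  obtains B where "\<And>q. q \<in> \<Omega> \<Longrightarrow> snd q \<le> B"
proof -
  obtain p R where p: "p \<in> hyperbolic" and R: "\<And>q. q \<in> \<Omega> \<Longrightarrow> hyp_dist p q \<le> R"
    using assms(1) by (auto simp: hyp_bounded_def)
  \<comment> \<open>Replacing \<open>R\<close> by \<open>max R 0 + 1\<close> makes the radius
    positive and the distance bound strict, as \<open>hyp_dist_less_iff\<close> requires.\<close>
  have "snd q \<le> 2 * snd p * cosh (max R 0 + 1)" if q: "q \<in> \<Omega>" for q
  proof -
    have q': "q \<in> hyperbolic" and r: "max R 0 + 1 > 0"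
      using q assms(2) by auto
    have "hyp_dist p q < max R 0 + 1"
      using R[OF q] by linarith
    hence "- lorentz p q \<le> cosh (max R 0 + 1)"
      unfolding hyp_dist_less_iff[OF p q' r] by (rule less_imp_le)
    hence "2 * snd p * (- lorentz p q) \<le> 2 * snd p * cosh (max R 0 + 1)"
      using hyperbolicD(2)[OF p] by (intro mult_left_mono) auto
    thus ?thesis
      using snd_le_lorentz[OF p q'] by linarith
  qed
  thus ?thesis
    by (rule that)
qed

text \<open>On the hyperboloid the height dominates the spatial norm, so bounded height means
  Euclidean boundedness.\<close>

lemma compact_hyperbolic_subset:
  fixes S :: "'n::finite lspace set"
  assumes "closed S" "S \<subseteq> hyperbolic" "\<And>q. q \<in> S \<Longrightarrow> snd q \<le> B"
  shows "compact S"
proof -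
  have "norm q \<le> B + B" if "q \<in> S" for q
  proof -
    have "norm q \<le> norm (fst q) + norm (snd q)"
      using norm_Pair_le[of "fst q" "snd q"] by simp
    thus ?thesis
      using hyperbolicD[of q] assms(2) assms(3)[OF that] that by fastforce
  qed
  thus ?thesis
    using assms(1) unfolding compact_eq_bounded_closed bounded_iff by blast
qed

lemma scaleR_in_cone_over: "q \<in> A \<Longrightarrow> 0 < l \<Longrightarrow> l *\<^sub>R q \<in> cone_over A"
  unfolding cone_over_def by blast

text \<open>Integrates the sign condition along a ray. A bound on \<open>deriv\<close> is
  informative only where the function is differentiable, so differentiability of \<open>H\<close> is
  asked for along the segment.\<close>

lemma scaled_nonincreasing:
  fixes H :: "'a::real_normed_vector \<Rightarrow> real"
  assumes "a \<le> b"
    and "\<And>l. l \<in> {a..b} \<Longrightarrow> H differentiable (at (l *\<^sub>R q))"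
    and "\<And>l. l \<in> {a..b} \<Longrightarrow> deriv (\<lambda>s. s * H (s *\<^sub>R q)) l \<le> 0"
  shows "b * H (b *\<^sub>R q) \<le> a * H (a *\<^sub>R q)"
proof (rule DERIV_nonpos_imp_nonincreasing[OF assms(1)])
  fix l assume "a \<le> l" "l \<le> b"
  hence l: "l \<in> {a..b}"
    by simp
  have "(\<lambda>s :: real. s *\<^sub>R q) differentiable (at l)"
    by (intro derivative_intros)
  hence "(H \<circ> (\<lambda>s :: real. s *\<^sub>R q)) differentiable (at l)"
    by (rule differentiable_chain_at) (rule assms(2)[OF l])
  hence "(\<lambda>s. s * H (s *\<^sub>R q)) differentiable (at l)"
    unfolding o_def by (intro differentiable_mult differentiable_ident)
  thus "\<exists>y. DERIV (\<lambda>s. s * H (s *\<^sub>R q)) l :> y \<and> y \<le> 0"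
    using assms(3)[OF l] DERIV_deriv_iff_real_differentiable by blast
qed

section \<open>Choice of uniform constants and verification of admissibility\<close>

theorem proposition4p7:
  fixes \<Omega> :: "'n::finite lspace set" and H :: "'n lspace \<Rightarrow> real"
  assumes "CARD('n) \<ge> 2"
    and "hyp_domain \<Omega>" and "hyp_bounded \<Omega>"
    and "exterior_ball_condition \<Omega>"
    and "C1_upto (cone_over \<Omega>) (cone_over (hyp_top closure_of \<Omega>)) H"
    and "\<And>q l. q \<in> hyp_top closure_of \<Omega> \<Longrightarrow> l > 0 \<Longrightarrow> H (l *\<^sub>R q) > 0"
    and "\<And>q l. q \<in> hyp_top closure_of \<Omega> \<Longrightarrow> l > 0 \<Longrightarrow>
           deriv (\<lambda>s. s * H (s *\<^sub>R q)) l \<le> 0"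
  shows "admissible \<Omega> H"
proof -
  let ?cl = "hyp_top closure_of \<Omega>" and ?bd = "hyp_top frontier_of \<Omega>"
  have \<Omega>: "\<Omega> \<subseteq> hyperbolic"
    using assms(2) openin_subset[of hyp_top \<Omega>] by (simp add: hyp_domain_def)
  have \<Omega>_cl: "\<Omega> \<subseteq> ?cl"
    using \<Omega> by (intro closure_of_subset) simp
  have cl_hyp: "?cl \<subseteq> hyperbolic"
    using closure_of_subset_topspace[of hyp_top \<Omega>] by simp
  have bd_cl: "?bd \<subseteq> ?cl"
    by (simp add: frontier_of_def)
  have closed: "closed ?cl"
    using closedin_closed_trans[OF closedin_closure_of closed_hyperbolic] .
  obtain B where "\<And>q. q \<in> \<Omega> \<Longrightarrow> snd q \<le> B"
    using hyp_bounded_imp_snd_bounded[OF assms(3) \<Omega>] by blast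
  hence "?cl \<subseteq> {x. snd x \<le> B}"
    by (intro hyp_closure_subset[OF _ \<Omega>] closed_Collect_le continuous_intros) auto
  hence B: "snd q \<le> B" if "q \<in> ?cl" for q
    using that by blast
  have "compact ?cl"
    using compact_hyperbolic_subset[OF closed cl_hyp B] by blast
  moreover have "?cl \<subseteq> cone_over ?cl"
    unfolding cone_over_def by (force intro: exI[of _ 1])
  hence "continuous_on ?cl H"
    using assms(5) continuous_on_subset by (auto simp: C1_upto_def)
  ultimately have "bounded (H ` ?cl)"
    by (intro compact_imp_bounded compact_continuous_image)
  then obtain M where M: "M > 0" "\<And>q. q \<in> ?cl \<Longrightarrow> \<bar>H q\<bar> \<le> M"
    by (auto simp: bounded_pos)
  obtain \<sigma> \<Xi> where \<sigma>: "\<sigma> > 0" and \<Xi>: "\<And>q. q \<in> ?bd \<Longrightarrow> \<Xi> q \<in> hyperbolic"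
      "\<And>q. q \<in> ?bd \<Longrightarrow> q \<in> hyp_top frontier_of (geodesic_ball (\<Xi> q) \<sigma>)"
      "\<And>q. q \<in> ?bd \<Longrightarrow> geodesic_ball (\<Xi> q) \<sigma> \<subseteq> hyperbolic - ?cl"
    using assms(4) unfolding exterior_ball_condition_def by blast
  obtain DH where DH: "\<And>x. x \<in> cone_over \<Omega> \<Longrightarrow> (H has_derivative blinfun_apply (DH x)) (at x)"
    using assms(5) unfolding C1_upto_def by blast
  define n where "n = real CARD('n)"
  have n: "n \<ge> 1"
    by (simp add: n_def Suc_leI)
  \<comment> \<open>The summand \<open>n * M\<close> serves the upper barrier and \<open>n\<close>
    the lower one.\<close>
  define C where "C = (n - 1) * (cosh \<sigma> / sinh \<sigma>) + n * M + n"
  \<comment> \<open>\<open>S\<close> bounds the cosh of the distance from any centre to any point of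
    the closure. In \<open>R\<close>, the entry \<open>\<sigma> + 1\<close> ensures
    \<open>\<sigma> < R\<close>, and \<open>max 1 S\<close> keeps the argument in the domain of
    \<open>arcosh\<close>.\<close>
  define S where "S = 4 * B\<^sup>2 * cosh \<sigma>"
  define R where "R = max (\<sigma> + 1) (arcosh (max 1 S))"
  have "C \<ge> n"
    using n \<sigma> M(1) by (simp add: C_def)
  have R: "\<sigma> < R" and C: "0 < C"
    using n \<open>C \<ge> n\<close> by (auto simp: R_def)
  have "cosh (arcosh (max 1 S)) \<le> cosh R"
    by (subst cosh_real_nonneg_le_iff) (auto simp: R_def le_max_iff_disj)
  hence S_R: "S \<le> cosh R"
    by simp
  have ht: "- lorentz (\<Xi> q0) q0 = cosh \<sigma>" if "q0 \<in> ?bd" for q0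
    using frontier_of_geodesic_ball[OF \<Xi>(1)[OF that] \<sigma> \<Xi>(2)[OF that]] .
  \<comment> \<open>The lower bound is the disjointness of the exterior ball from the closure. For
    the upper bound, \<open>q0\<close> has height at most \<open>B\<close> and lies at distance
    \<sigma> from its centre, which limits the height of the centre uniformly.\<close>
  have range: "cosh \<sigma> \<le> - lorentz (\<Xi> q0) q" "- lorentz (\<Xi> q0) q \<le> cosh R"
    if q0: "q0 \<in> ?bd" and q: "q \<in> ?cl" for q0 q
  proof -
    have hyp: "\<Xi> q0 \<in> hyperbolic" "q0 \<in> hyperbolic" "q \<in> hyperbolic"
      using \<Xi>(1)[OF q0] q q0 bd_cl cl_hyp by auto
    have "q \<notin> geodesic_ball (\<Xi> q0) \<sigma>"
      using \<Xi>(3)[OF q0] q by blast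
    thus "cosh \<sigma> \<le> - lorentz (\<Xi> q0) q"
      using hyp_dist_less_iff[OF hyp(1,3) \<sigma>] hyp(3) by (simp add: geodesic_ball_def not_less)
    have pos: "snd (\<Xi> q0) > 0" "snd q > 0" "snd q0 > 0"
      using hyp by (auto dest: hyperbolicD(2))
    have le_B: "snd q \<le> B" "snd q0 \<le> B"
      using B q q0 bd_cl by blast+
    have "snd (\<Xi> q0) \<le> 2 * snd q0 * cosh \<sigma>"
      using snd_le_lorentz[OF hyp(2,1)] unfolding lorentz_commute[of q0] ht[OF q0] .
    also have "\<dots> \<le> 2 * B * cosh \<sigma>"
      using le_B by (intro mult_right_mono) auto
    finally have "2 * snd (\<Xi> q0) * snd q \<le> 2 * (2 * B * cosh \<sigma>) * B"
      using le_B pos by (intro mult_mono) auto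
    also have "\<dots> = S"
      by (simp add: S_def power2_eq_square)
    finally show "- lorentz (\<Xi> q0) q \<le> cosh R"
      using lorentz_le_snd[OF hyp(1,3)] S_R by linarith
  qed
  \<comment> \<open>\<open>1 - \<theta>\<close> is the midpoint between the gradient bound
    \<open>slope_max\<close> and \<open>1\<close>; it depends on neither \<open>q0\<close> nor
    \<open>t\<close>.\<close>
  define \<theta> where "\<theta> = (1 - tanh (C * (R - \<sigma>))) / 2"
  have tanh: "0 < tanh (C * (R - \<sigma>))" "tanh (C * (R - \<sigma>)) < 1"
    using C R tanh_real_lt_1 by auto
  show ?thesis
    unfolding admissible_def
  proof (intro exI[of _ \<theta>] conjI ballI)
    show "0 < \<theta>" "\<theta> < 1"
      using tanh less_trans[OF _ tanh(1), of "- 1"] by (simp_all add: \<theta>_def)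
    fix q0 t assume q0: "q0 \<in> ?bd" and t: "t \<in> {0..1 :: real}"
    interpret sub: barrier "\<Xi> q0" \<sigma> R C "- 1"
      by unfold_locales (use \<Xi>(1)[OF q0] \<sigma> R C in auto)
    interpret sup: barrier "\<Xi> q0" \<sigma> R C 1
      by unfold_locales (use \<Xi>(1)[OF q0] \<sigma> R C in auto)
    have ann: "?cl \<subseteq> sub.annulus" "?cl \<subseteq> sup.annulus"
      using range[OF q0] cl_hyp by (auto simp: sub.annulus_def sup.annulus_def)
    have max: "sub.slope_max \<le> 1 - \<theta>" "sup.slope_max \<le> 1 - \<theta>"
      using tanh by (simp_all add: sub.slope_max_def sup.slope_max_def \<theta>_def field_simps)
    have \<phi>_sup: "sup.\<phi> q \<ge> 0" and \<phi>_sub: "sub.\<phi> q \<le> 0" if "q \<in> ?cl" for q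
      using sup.\<phi>_sign[OF subsetD[OF ann(2) that]] sub.\<phi>_sign[OF subsetD[OF ann(1) that]]
      by simp_all
    show "\<exists>\<phi>1 \<phi>2. C2_closure \<Omega> \<phi>1 \<and> C2_closure \<Omega> \<phi>2 \<and>
          (\<forall>q\<in>\<Omega>. gnorm (hyp_grad \<phi>1 q) \<le> 1 - \<theta>) \<and> (\<forall>q\<in>\<Omega>. gnorm (hyp_grad \<phi>2 q) \<le> 1 - \<theta>) \<and>
          \<phi>1 q0 = 0 \<and> (\<forall>q \<in> ?bd. \<phi>1 q \<le> 0) \<and> \<phi>2 q0 = 0 \<and> (\<forall>q \<in> ?bd. \<phi>2 q \<ge> 0) \<and>
          (\<forall>q\<in>\<Omega>. \<forall>e. orthonormal_frame q e \<longrightarrow> Qop H t \<phi>1 q e \<ge> 0) \<and>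
          (\<forall>q\<in>\<Omega>. \<forall>e. orthonormal_frame q e \<longrightarrow> Qop H t \<phi>2 q e \<le> 0)"
    proof (rule exI[of _ sub.\<phi>], rule exI[of _ sup.\<phi>], intro conjI ballI allI impI)
      show "C2_closure \<Omega> sub.\<phi>" "C2_closure \<Omega> sup.\<phi>"
        using sub.C2_closure_\<phi>[OF ann(1) \<Omega>_cl] sup.C2_closure_\<phi>[OF ann(2) \<Omega>_cl] by blast+
      show "gnorm (hyp_grad sub.\<phi> q) \<le> 1 - \<theta>" if "q \<in> \<Omega>" for q
        using sub.gnorm_hyp_grad_le max(1) subsetD[OF ann(1)] subsetD[OF \<Omega>_cl that]
        by (meson order_trans)
      show "gnorm (hyp_grad sup.\<phi> q) \<le> 1 - \<theta>" if "q \<in> \<Omega>" for q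
        using sup.gnorm_hyp_grad_le max(2) subsetD[OF ann(2)] subsetD[OF \<Omega>_cl that]
        by (meson order_trans)
      show "sub.\<phi> q0 = 0" "sup.\<phi> q0 = 0"
        by (intro sub.\<phi>_eq_0 sup.\<phi>_eq_0 ht[OF q0])+
      show "sub.\<phi> q \<le> 0" "sup.\<phi> q \<ge> 0" if "q \<in> ?bd" for q
        using \<phi>_sub \<phi>_sup bd_cl that by blast+
      fix q e assume q: "q \<in> \<Omega>" and e: "orthonormal_frame q e"
      have q_cl: "q \<in> ?cl"
        using q \<Omega>_cl by blast
      have t01: "0 \<le> t" "t \<le> 1"
        using t by simp_all
      have C_ge: "(n - 1) * (cosh \<sigma> / sinh \<sigma>) + n \<le> C" "(n - 1) * (cosh \<sigma> / sinh \<sigma>) + n * M \<le> C"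
        using n M(1) by (simp_all add: C_def)
      have "0 \<le> H (exp (sub.\<phi> q) *\<^sub>R q)"
        by (rule less_imp_le[OF assms(6)[OF q_cl exp_gt_zero]])
      thus "0 \<le> Qop H t sub.\<phi> q e"
        by (rule sub.Qop_subsolution[OF refl subsetD[OF ann(1) q_cl] e t01 _ C_ge(1)[unfolded n_def]])
      \<comment> \<open>The upper barrier is nonnegative on the closure, so the segment from
        \<open>1\<close> to \<open>exp (sup.\<phi> q)\<close> is traversed in the direction in which
        the scaled \<open>H\<close> does not increase. As \<open>q\<close> lies in \<Omega> itself,
        its ray stays in the cone where \<open>H\<close> is differentiable.\<close>
      have le_1: "exp (sup.\<phi> q) * H (exp (sup.\<phi> q) *\<^sub>R q) \<le> 1 * H (1 *\<^sub>R q)"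
      proof (rule scaled_nonincreasing[where H = H and q = q and a = 1 and b = "exp (sup.\<phi> q)"])
        show "1 \<le> exp (sup.\<phi> q)"
          unfolding one_le_exp_iff by (rule \<phi>_sup[OF q_cl])
        fix l assume l: "l \<in> {1..exp (sup.\<phi> q)}"
        show "deriv (\<lambda>s. s * H (s *\<^sub>R q)) l \<le> 0"
          using l by (intro assms(7)[OF q_cl]) simp
        have "l *\<^sub>R q \<in> cone_over \<Omega>"
          using l by (intro scaleR_in_cone_over q) simp
        thus "H differentiable (at (l *\<^sub>R q))"
          by (rule differentiableI[OF DH])
      qed
      have "1 * H (1 *\<^sub>R q) \<le> M"
        using M(2)[OF q_cl] by simp
      with le_1 have "exp (sup.\<phi> q) * H (exp (sup.\<phi> q) *\<^sub>R q) \<le> M"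
        by linarith
      thus "Qop H t sup.\<phi> q e \<le> 0"
        by (rule sup.Qop_supersolution[where H = H and M = M and p = q and e = e and t = t,
              OF refl subsetD[OF ann(2) q_cl] e t01 less_imp_le[OF M(1)] _ C_ge(2)[unfolded n_def]])
    qed
  qed
qed

end
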